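(* Let $\mathcal{V}=(\Sigma,n,\delta)$ be a vector addition system and let $S,S'\subseteq\mathbb{N}^n$ be semi-linear sets. Then $\mathrm{post}^*_{\mathcal{V}}(S)$ and $\mathrm{pre}^*_{\mathcal{V}}(S')$ are Petri sets.
   Context: A VAS is $\mathcal{V}=(\Sigma,n,\delta)$ with $\Sigma$ a finite nonempty alphabet, $n\in\mathbb{N}$, $\delta:\Sigma\to\mathbb{Z}^n$. For configurations $\vec{x},\vec{x}'\in\mathbb{N}^n$ and $a\in\Sigma$, $\vec{x}\xrightarrow{a}_{\mathcal{V}}\vec{x}'$ iff $\vec{x}'=\vec{x}+\delta(a)$; words act by composition and $\xrightarrow{*}_{\mathcal{V}}$ is the union over all words. $\mathrm{post}^*_{\mathcal{V}}(S)=\{\vec{s}'\in\mathbb{N}^n\mid\exists\vec{s}\in S,\ \vec{s}\xrightarrow{*}_{\mathcal{V}}\vec{s}'\}$ and $\mathrm{pre}^*_{\mathcal{V}}(S')=\{\vec{s}\in\mathbb{N}^n\mid\exists\vec{s}'\in S',\ \vec{s}\xrightarrow{*}_{\mathcal{V}}\vec{s}'\}$. A monoid of $\mathbb{Q}^n$ is a set $M$ with $\vec{0}\in M$ and $M+M\subseteq M$; $X^*$ is the monoid generated by $X$; $M$ is finitely generated if $M=P^*$ for a finite $P$. A vector $\vec{a}\in M$ is interior to $M$ if for every $\vec{x}\in M$ there is an integer $N\geq1$ with $N\vec{a}\in\vec{x}+M$. A set $L\subseteq\mathbb{Z}^n$ is linear if $L=\vec{b}+M$ with $\vec{b}\in\mathbb{Z}^n$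 and $M\subseteq\mathbb{Z}^n$ a finitely generated monoid; semi-linear sets are finite unions of linear sets. A set $X\subseteq\mathbb{Z}^n$ is pseudo-linear if there are $\vec{b}\in\mathbb{Z}^n$ and a finitely generated monoid $M\subseteq\mathbb{Z}^n$ with $X\subseteq\vec{b}+M$ such that for every finite set $R$ of interior vectors of $M$ there is $\vec{x}\in X$ with $\vec{x}+R^*\subseteq X$. A semi-pseudo-linear set is a finite (possibly empty) union of pseudo-linear sets. A set $X\subseteq\mathbb{Z}^n$ is a Petri set if $X\cap S$ is semi-pseudo-linear for every semi-linear $S\subseteq\mathbb{Z}^n$. *)

theory Defs
  imports Main "HOL-Library.Function_Algebras" "HOL.Hull"
begin

text \<open>
  The dimension \<open>n\<close> is an arbitrary natural number, zero included, so a vector of dimension \<open>n\<close>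
  is encoded as a function \<open>nat \<Rightarrow> int\<close> that vanishes at all indices \<open>\<ge> n\<close>.  With this encoding
  the pointwise \<open>0\<close> and \<open>+\<close> of \<open>HOL-Library.Function_Algebras\<close> are the vector operations.
  Monoids of rational vectors are not needed: all monoids below consist of integer vectors.
\<close>

type_synonym ivec = "nat \<Rightarrow> int"

definition int_vecs :: "nat \<Rightarrow> ivec set" where
  "int_vecs n = {x. \<forall>i\<ge>n. x i = 0}"

definition nat_vecs :: "nat \<Rightarrow> ivec set" where
  "nat_vecs n = {x \<in> int_vecs n. \<forall>i<n. 0 \<le> x i}"

definition additive_monoid :: "'a::monoid_add set \<Rightarrow> bool" where
  "additive_monoid M \<longleftrightarrow> 0 \<in> M \<and> (\<forall>x\<in>M. \<forall>y\<in>M. x + y \<in> M)"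

definition generated_monoid :: "'a::monoid_add set \<Rightarrow> 'a set" where
  "generated_monoid X = additive_monoid hull X"

definition fin_gen_monoid :: "'a::monoid_add set \<Rightarrow> bool" where
  "fin_gen_monoid M \<longleftrightarrow> (\<exists>P. finite P \<and> M = generated_monoid P)"

definition interior_vec :: "ivec \<Rightarrow> ivec set \<Rightarrow> bool" where
  "interior_vec a M \<longleftrightarrow>
     a \<in> M \<and> (\<forall>x\<in>M. \<exists>N::int. N \<ge> 1 \<and> (\<lambda>i. N * a i) \<in> (+) x ` M)"

definition linear_set :: "nat \<Rightarrow> ivec set \<Rightarrow> bool" where
  "linear_set n L \<longleftrightarrow>
     (\<exists>b M. b \<in> int_vecs n \<and> M \<subseteq> int_vecs n \<and> fin_gen_monoid M \<and> L = (+) b ` M)"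

definition semilinear_set :: "nat \<Rightarrow> ivec set \<Rightarrow> bool" where
  "semilinear_set n S \<longleftrightarrow> (\<exists>F. finite F \<and> (\<forall>L\<in>F. linear_set n L) \<and> S = \<Union>F)"

definition pseudo_linear_set :: "nat \<Rightarrow> ivec set \<Rightarrow> bool" where
  "pseudo_linear_set n X \<longleftrightarrow> X \<subseteq> int_vecs n \<and>
     (\<exists>b M. b \<in> int_vecs n \<and> M \<subseteq> int_vecs n \<and> fin_gen_monoid M \<and> X \<subseteq> (+) b ` M \<and>
        (\<forall>R. finite R \<and> (\<forall>a\<in>R. interior_vec a M) \<longrightarrow>
           (\<exists>x\<in>X. (+) x ` generated_monoid R \<subseteq> X)))"

definition semi_pseudo_linear_set :: "nat \<Rightarrow> ivec set \<Rightarrow> bool" where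
  "semi_pseudo_linear_set n X \<longleftrightarrow>
     (\<exists>F. finite F \<and> (\<forall>Y\<in>F. pseudo_linear_set n Y) \<and> X = \<Union>F)"

definition Petri_set :: "nat \<Rightarrow> ivec set \<Rightarrow> bool" where
  "Petri_set n X \<longleftrightarrow> X \<subseteq> int_vecs n \<and>
     (\<forall>S. semilinear_set n S \<longrightarrow> semi_pseudo_linear_set n (X \<inter> S))"

record 'a vas =
  alphabet :: "'a set"
  dimension :: nat
  displacement :: "'a \<Rightarrow> ivec"

definition is_vas :: "'a vas \<Rightarrow> bool" where
  "is_vas V \<longleftrightarrow> finite (alphabet V) \<and> alphabet V \<noteq> {} \<and>
     (\<forall>a\<in>alphabet V. displacement V a \<in> int_vecs (dimension V))"

definition vas_step :: "'a vas \<Rightarrow> 'a \<Rightarrow> ivec \<Rightarrow> ivec \<Rightarrow> bool" where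
  "vas_step V a x x' \<longleftrightarrow> a \<in> alphabet V \<and>
     x \<in> nat_vecs (dimension V) \<and> x' \<in> nat_vecs (dimension V) \<and> x' = x + displacement V a"

fun vas_run :: "'a vas \<Rightarrow> 'a list \<Rightarrow> ivec \<Rightarrow> ivec \<Rightarrow> bool" where
  "vas_run V [] x x' \<longleftrightarrow> x \<in> nat_vecs (dimension V) \<and> x' = x"
| "vas_run V (a # w) x x' \<longleftrightarrow> (\<exists>y. vas_step V a x y \<and> vas_run V w y x')"

definition vas_reach :: "'a vas \<Rightarrow> ivec \<Rightarrow> ivec \<Rightarrow> bool" where
  "vas_reach V x x' \<longleftrightarrow> (\<exists>w \<in> lists (alphabet V). vas_run V w x x')"

definition post_star :: "'a vas \<Rightarrow> ivec set \<Rightarrow> ivec set" where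
  "post_star V S = {s' \<in> nat_vecs (dimension V). \<exists>s\<in>S. vas_reach V s s'}"

definition pre_star :: "'a vas \<Rightarrow> ivec set \<Rightarrow> ivec set" where
  "pre_star V S' = {s \<in> nat_vecs (dimension V). \<exists>s'\<in>S'. vas_reach V s s'}"

end

theory Submission
  imports Defs "HOL-Library.Sublist" "HOL-Library.Ramsey" "HOL-Library.Multiset"
begin

text \<open>
  Order the runs from one linear set to another by Higman's embedding of sequences of configurations
  (Jancar); this is a well-quasi-order.  The end points of the runs above a run \<open>c\<^sub>0, \<dots>, c\<^sub>k\<close> differ
  from those of that run by the elements of a monoid, composed of the relations
  \<open>{(x, y). c\<^sub>j + x \<rightarrow>\<^sup>* c\<^sub>j + y}\<close> (Leroux).  Taking \<open>k + 1\<close> copies of the system turns the composition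
  into a single such relation at one configuration \<open>c\<close>, subject to linear side conditions.

  Let \<open>Z\<close> be the monoid of solutions, and \<open>J\<close> the set of counters that can be increased in the middle
  of some path \<open>c + x \<rightarrow>\<^sup>* c + h \<rightarrow>\<^sup>* c + y\<close> of \<open>Z\<close>.  By Dickson's lemma the counters outside \<open>J\<close> take
  finitely many values along such paths, so that ignoring \<open>J\<close> gives a finite strongly connected graph.
  Relaxing reachability to the condition that \<open>y - x\<close> is a sum of displacements of cycles of this graph
  yields a finitely generated monoid \<open>W \<supseteq> Z\<close>.  Pumping the counters in \<open>J\<close> gives a \<open>z \<in> Z\<close> such that
  every \<open>w \<in> W\<close> lies in \<open>Z - Z\<close> and some multiple of \<open>z + w\<close> lies in \<open>Z\<close>.  Hence interior vectors of
  \<open>W\<close> are differences of elements of \<open>Z\<close> with a multiple in \<open>Z\<close>, which is pseudo-linearity.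
\<close>

subsection \<open>Well-quasi-orders\<close>

text \<open>A bare good-pair condition for an arbitrary relation. Reflexivity is not built in, which
  is why the finite bases below allow equality as an alternative.\<close>

definition wqo :: "('a \<Rightarrow> 'a \<Rightarrow> bool) \<Rightarrow> 'a set \<Rightarrow> bool" where
  "wqo R A \<longleftrightarrow> (\<forall>f::nat \<Rightarrow> 'a. range f \<subseteq> A \<longrightarrow> (\<exists>i j. i < j \<and> R (f i) (f j)))"

lemma wqoD: "wqo R A \<Longrightarrow> (\<And>n. f n \<in> A) \<Longrightarrow> \<exists>i j. i < j \<and> R (f i) (f j)" for f :: "nat \<Rightarrow> 'a"
  unfolding wqo_def by blast

lemma wqo_subset: "wqo R A \<Longrightarrow> B \<subseteq> A \<Longrightarrow> wqo R B"
  unfolding wqo_def by (meson order_trans)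

lemma wqo_inv_image:
  assumes "wqo R B" "h ` A \<subseteq> B" "\<And>x y. x \<in> A \<Longrightarrow> y \<in> A \<Longrightarrow> R (h x) (h y) \<Longrightarrow> R' x y"
  shows "wqo R' A"
  unfolding wqo_def
proof (intro allI impI)
  fix f :: "nat \<Rightarrow> 'b" assume f: "range f \<subseteq> A"
  then obtain i j where "i < j" "R (h (f i)) (h (f j))"
    using wqoD[OF assms(1), of "\<lambda>n. h (f n)"] assms(2) by blast
  then show "\<exists>i j. i < j \<and> R' (f i) (f j)"
    using assms(3) f by blast
qed

lemma wqo_image:
  assumes "wqo R A" "\<And>x y. x \<in> A \<Longrightarrow> y \<in> A \<Longrightarrow> R x y \<Longrightarrow> R' (h x) (h y)"
  shows "wqo R' (h ` A)"
proof (rule wqo_inv_image[OF assms(1), where h = "inv_into A h"])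
  show "inv_into A h ` h ` A \<subseteq> A" by (auto intro: inv_into_into)
  fix x y assume "x \<in> h ` A" "y \<in> h ` A" "R (inv_into A h x) (inv_into A h y)"
  then show "R' x y"
    using assms(2)[of "inv_into A h x" "inv_into A h y"]
    by (simp add: inv_into_into f_inv_into_f)
qed

text \<open>By Ramsey's theorem some infinite index set is homogeneous for the property of being a
  good pair; were all its pairs bad, it would enumerate a bad sequence.\<close>

lemma wqo_subseq:
  assumes "wqo R A" and f: "range f \<subseteq> A"
  obtains g :: "nat \<Rightarrow> nat" where "strict_mono g" "\<And>i j. i < j \<Longrightarrow> R (f (g i)) (f (g j))"
proof -
  \<comment> \<open>Colours live on two-element sets; \<open>Min\<close> and \<open>Max\<close>
    recover the order of the two indices.\<close>
  define col where "col s = (if R (f (Min s)) (f (Max s)) then 0 else 1::nat)" for s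
  have col2: "col {i, j} = (if R (f i) (f j) then 0 else 1)" if "i < j" for i j
    using that by (simp add: col_def)
  have "\<forall>x\<in>UNIV. \<forall>y\<in>UNIV. x \<noteq> y \<longrightarrow> col {x, y} < 2"
    by (simp add: col_def)
  from Ramsey2[OF infinite_UNIV_nat this]
  obtain Y t where Y: "infinite Y" and t: "\<forall>x\<in>Y. \<forall>y\<in>Y. x \<noteq> y \<longrightarrow> col {x, y} = t"
    by blast
  let ?g = "enumerate Y"
  have mono: "strict_mono ?g" by (rule strict_mono_enumerate[OF Y])
  have colg: "col {?g i, ?g j} = t" if "i < j" for i j
  proof -
    have "?g i < ?g j" using that mono by (simp add: strict_mono_less)
    then show ?thesis
      using t enumerate_in_set[OF Y] by (metis less_irrefl)
  qed
  obtain i j where "i < j" "R (f (?g i)) (f (?g j))"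
    using wqoD[OF assms(1), of "\<lambda>n. f (?g n)"] f by blast
  moreover from this have "t = 0"
    using colg[of i j] col2[of "?g i" "?g j"] mono by (simp add: strict_mono_less)
  ultimately have "R (f (?g i)) (f (?g j))" if "i < j" for i j
    using colg[OF that] col2[of "?g i" "?g j"] mono that
    by (simp add: strict_mono_less split: if_splits)
  with mono show thesis by (rule that)
qed

text \<open>A good pair for \<open>R'\<close> is sought inside a subsequence all of whose pairs are
  already good for \<open>R\<close>.\<close>

lemma wqo_conj:
  assumes "wqo R A" "wqo R' A"
  shows "wqo (\<lambda>x y. R x y \<and> R' x y) A"
  unfolding wqo_def
proof (intro allI impI)
  fix f :: "nat \<Rightarrow> 'a" assume f: "range f \<subseteq> A"
  obtain g :: "nat \<Rightarrow> nat" where g: "strict_mono g" "\<And>i j. i < j \<Longrightarrow> R (f (g i)) (f (g j))"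
    using wqo_subseq[OF assms(1) f] by blast
  obtain i j where "i < j" "R' (f (g i)) (f (g j))"
    using wqoD[OF assms(2), of "\<lambda>n. f (g n)"] f by blast
  then show "\<exists>i j. i < j \<and> R (f i) (f j) \<and> R' (f i) (f j)"
    using g by (meson strict_mono_less)
qed

lemma wqo_ball:
  assumes "finite I" "\<And>i. i \<in> I \<Longrightarrow> wqo (R i) A"
  shows "wqo (\<lambda>x y. \<forall>i\<in>I. R i x y) A"
  using assms
proof (induction I rule: finite_induct)
  case empty
  show ?case unfolding wqo_def using zero_less_one by blast
next
  case (insert i I)
  then show ?case using wqo_conj[of "R i" A] by simp
qed

lemma wqo_nat: "wqo (\<le>) (UNIV :: nat set)"
  unfolding wqo_def
proof (intro allI impI, rule ccontr)
  fix f :: "nat \<Rightarrow> nat"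
  assume "\<not> (\<exists>i j. i < j \<and> f i \<le> f j)"
  then have "\<forall>i. f (Suc i) < f i" by (meson lessI not_le)
  then show False
    using wf_less wf_iff_no_infinite_down_chain[of "{(x, y::nat). x < y}"] by blast
qed

lemma wqo_finite_eq:
  assumes "finite A"
  shows "wqo (=) A"
  unfolding wqo_def
proof (intro allI impI)
  fix f :: "nat \<Rightarrow> 'a" assume "range f \<subseteq> A"
  then have "\<not> inj f" using assms finite_imageD finite_subset infinite_UNIV_nat by blast
  then show "\<exists>i j. i < j \<and> f i = f j"
    unfolding inj_def by (metis linorder_neqE_nat)
qed

text \<open>If every finite subset missed some element, choosing missed elements again and again
  would produce a bad sequence.\<close>

lemma wqo_finite_basis:
  assumes wqo: "wqo R A"
  obtains B where "finite B" "B \<subseteq> A" "\<And>x. x \<in> A \<Longrightarrow> \<exists>b\<in>B. b = x \<or> R b x"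
proof (rule ccontr)
  assume "\<not> thesis"
  with that have no: "\<exists>x\<in>A. \<forall>b\<in>B. \<not> R b x" if "finite B" "B \<subseteq> A" for B
    using \<open>finite B\<close> \<open>B \<subseteq> A\<close> by meson
  define next_elem where "next_elem B = (SOME x. x \<in> A \<and> (\<forall>b\<in>B. \<not> R b x))" for B
  have nxt: "next_elem B \<in> A \<and> (\<forall>b\<in>B. \<not> R b (next_elem B))" if "finite B" "B \<subseteq> A" for B
    unfolding next_elem_def using someI_ex[of "\<lambda>x. x \<in> A \<and> (\<forall>b\<in>B. \<not> R b x)"] no[OF that] by blast
  \<comment> \<open>\<open>C n\<close> collects the first \<open>n\<close> choices; each new choice
    is above none of them.\<close>
  define C where "C = rec_nat {} (\<lambda>_ B. insert (next_elem B) B)"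
  have C_Suc: "C (Suc n) = insert (next_elem (C n)) (C n)" and C_0: "C 0 = {}" for n
    by (simp_all add: C_def)
  have C: "finite (C n) \<and> C n \<subseteq> A" for n
    by (induction n) (use nxt in \<open>auto simp: C_0 C_Suc\<close>)
  have C_mono: "C m \<subseteq> C n" if "m \<le> n" for m n
    using that by (rule lift_Suc_mono_le[of C, rotated]) (auto simp: C_Suc)
  let ?f = "\<lambda>n. next_elem (C n)"
  have "range ?f \<subseteq> A" using C nxt by blast
  then obtain i j where ij: "i < j" "R (?f i) (?f j)"
    using wqo unfolding wqo_def by blast
  have "?f i \<in> C j" using C_mono[of "Suc i" j] ij(1) by (auto simp: C_Suc)
  then show False using nxt[of "C j"] C ij(2) by blast
qed

section \<open>The lemmas of Dickson and Higman\<close>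

text \<open>A copy of \<open>\<nat>^I\<close> inside the functions on any index type, so that
  \<open>I\<close> can be a set of counters, a subset of it, or a set of pairs of a copy and a
  counter.\<close>

definition nonneg_vecs :: "'i set \<Rightarrow> ('i \<Rightarrow> int) set" where
  "nonneg_vecs I = {x. 0 \<le> x \<and> (\<forall>i. i \<notin> I \<longrightarrow> x i = 0)}"

text \<open>Dickson's lemma: a finite conjunction of the well-quasi-orders given by the single
  coordinates.\<close>

lemma wqo_nonneg_vecs:
  assumes "finite I"
  shows "wqo (\<le>) (nonneg_vecs I)" (is "wqo _ ?A")
proof -
  have "wqo (\<lambda>x y. \<forall>i\<in>I. x i \<le> y i) ?A"
  proof (rule wqo_ball[OF assms])
    fix i
    show "wqo (\<lambda>x y. x i \<le> y i) ?A"
      by (rule wqo_inv_image[OF wqo_nat, where h = "\<lambda>x. nat (x i)"])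
        (auto simp: nonneg_vecs_def le_fun_def nat_le_eq_zle)
  qed
  then show ?thesis
    by (rule wqo_inv_image[where h = id]) (force simp: nonneg_vecs_def le_fun_def)+
qed

text \<open>Dickson's lemma again, now for vectors of multiplicities.\<close>

lemma wqo_mset:
  assumes "finite P"
  shows "wqo (\<subseteq>#) {M. set_mset M \<subseteq> P}"
proof -
  have "wqo (\<lambda>M N. \<forall>p\<in>P. count M p \<le> count N p) {M. set_mset M \<subseteq> P}"
  proof (rule wqo_ball[OF assms])
    fix p
    show "wqo (\<lambda>M N. count M p \<le> count N p) {M. set_mset M \<subseteq> P}"
      by (rule wqo_inv_image[OF wqo_nat, where h = "\<lambda>M. count M p"]) auto
  qed
  then show ?thesis
  proof (rule wqo_inv_image[where h = id])
    fix M N assume "M \<in> {M. set_mset M \<subseteq> P}" "\<forall>p\<in>P. count (id M) p \<le> count (id N) p"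
    then show "M \<subseteq># N"
      unfolding subseteq_mset_def by (metis (no_types, lifting) count_eq_zero_iff id_apply le0 mem_Collect_eq subsetD)
  qed auto
qed

text \<open>Higman's lemma, by Nash-Williams' minimal bad sequence argument: \<open>g n\<close> is the \<open>n\<close>-th entry
  of a bad sequence whose entries have successively been chosen of minimal length.\<close>

lemma higman:
  assumes wqo: "wqo R A"
  shows "wqo (list_emb R) (lists A)"
proof (rule ccontr)
  define bad where "bad f \<longleftrightarrow> range f \<subseteq> lists A \<and> (\<forall>i j. i < j \<longrightarrow> \<not> list_emb R (f i) (f j))"
    for f :: "nat \<Rightarrow> 'a list"
  assume "\<not> ?thesis"
  then obtain f0 where f0: "bad f0" unfolding bad_def wqo_def by blast
  define ext where "ext n f h \<longleftrightarrow> bad h \<and> (\<forall>i<n. h i = f i)" for n :: nat and f h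
  define minext where "minext n f = arg_min (\<lambda>h. length (h n)) (ext n f)" for n and f
  have minext: "ext n f (minext n f)" and minext_le: "ext n f h \<Longrightarrow> length (minext n f n) \<le> length (h n)"
    if "bad f" for n f h
  proof -
    have "ext n f f" using that by (simp add: ext_def)
    then show "ext n f (minext n f)" unfolding minext_def by (rule arg_min_natI[of "ext n f" f])
    show "ext n f h \<Longrightarrow> length (minext n f n) \<le> length (h n)"
      unfolding minext_def by (rule arg_min_nat_le[of "ext n f" h])
  qed
  \<comment> \<open>Stage \<open>n\<close> keeps the entries before \<open>n\<close> and minimises
    entry \<open>n\<close>. Later stages leave the entries up to \<open>n\<close> alone, so the
    diagonal \<open>g\<close> agrees with \<open>F n\<close> there.\<close>
  define F where "F = rec_nat (minext 0 f0) (\<lambda>n f. minext (Suc n) f)"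
  have F_0: "F 0 = minext 0 f0" and F_Suc: "F (Suc n) = minext (Suc n) (F n)" for n
    by (simp_all add: F_def)
  have bad_F: "bad (F n)" for n
    by (induction n) (use minext f0 in \<open>auto simp: F_0 F_Suc ext_def\<close>)
  define g where "g n = F n n" for n
  have F_g: "F n i = g i" if "i \<le> n" for i n
    using that
  proof (induction n)
    case 0
    then show ?case by (simp add: g_def)
  next
    case (Suc n)
    show ?case
    proof (cases "i = Suc n")
      case True
      then show ?thesis by (simp add: g_def)
    next
      case False
      then have "F (Suc n) i = F n i"
        using minext[OF bad_F, of "Suc n" n] Suc.prems unfolding F_Suc ext_def by auto
      then show ?thesis using Suc False by simp
    qed
  qed
  have g_lists: "g n \<in> lists A" for n using bad_F[of n] unfolding bad_def g_def by blast
  have g_bad: "\<not> list_emb R (g i) (g j)" if "i < j" for i j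
    using bad_F[of j] F_g[of i j] F_g[of j j] that unfolding bad_def by (metis less_imp_le order_refl)
  have g_min: "length (g n) \<le> length (h n)" if "bad h" "\<And>i. i < n \<Longrightarrow> h i = g i" for h n
  proof (cases n)
    case 0
    then show ?thesis using minext_le[OF f0, of 0 h] that(1) by (simp add: g_def F_0 ext_def)
  next
    case (Suc m)
    then have "ext n (F m) h" using that F_g[of _ m] by (simp add: ext_def less_Suc_eq_le)
    then show ?thesis using minext_le[OF bad_F] Suc by (simp add: g_def F_Suc)
  qed
  have g_ne: "g n \<noteq> []" for n
    using g_bad[of n "Suc n"] by auto
  have g_Cons: "g n = hd (g n) # tl (g n)" for n using g_ne by simp
  have "hd (g n) \<in> A" for n using g_lists[of n] g_ne[of n] by (cases "g n") auto
  then have "range (\<lambda>n. hd (g n)) \<subseteq> A" by blast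
  then obtain \<phi> :: "nat \<Rightarrow> nat" where mono: "strict_mono \<phi>"
    and R: "\<And>i j. i < j \<Longrightarrow> R (hd (g (\<phi> i))) (hd (g (\<phi> j)))"
    using wqo_subseq[OF wqo, of "\<lambda>n. hd (g n)"] by blast
  \<comment> \<open>From index \<open>\<phi> 0\<close> on, \<open>g\<close> is replaced by the tails
    of \<open>g (\<phi> 0)\<close>, \<open>g (\<phi> 1)\<close>, and so on. The heads along
    \<open>\<phi>\<close> form good pairs, so an embedding between tails would extend to one in
    \<open>g\<close>. Thus \<open>h\<close> is bad, but shorter than \<open>g\<close> at
    \<open>\<phi> 0\<close>.\<close>
  define h where "h i = (if i < \<phi> 0 then g i else tl (g (\<phi> (i - \<phi> 0))))" for i
  have "bad h"
    unfolding bad_def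
  proof (intro conjI allI impI)
    show "range h \<subseteq> lists A"
      using g_lists g_ne unfolding h_def lists_eq_set by (auto dest: list.set_sel(2))
    fix i j :: nat assume "i < j"
    consider "j < \<phi> 0" | "i < \<phi> 0" "\<phi> 0 \<le> j" | "\<phi> 0 \<le> i" by linarith
    then show "\<not> list_emb R (h i) (h j)"
    proof cases
      case 1
      then show ?thesis using g_bad \<open>i < j\<close> by (simp add: h_def)
    next
      case 2
      have "i < \<phi> (j - \<phi> 0)"
        using 2 mono by (metis le0 order_less_le_trans strict_mono_less_eq)
      then have "\<not> list_emb R (g i) (g (\<phi> (j - \<phi> 0)))" by (rule g_bad)
      then have "\<not> list_emb R (g i) (tl (g (\<phi> (j - \<phi> 0))))"
        using list_emb_Cons[of R "g i" _ "hd (g (\<phi> (j - \<phi> 0)))"] by (metis g_Cons)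
      then show ?thesis using 2 by (simp add: h_def)
    next
      case 3
      then have "i - \<phi> 0 < j - \<phi> 0" using \<open>i < j\<close> by linarith
      then have "R (hd (g (\<phi> (i - \<phi> 0)))) (hd (g (\<phi> (j - \<phi> 0))))"
        and "\<phi> (i - \<phi> 0) < \<phi> (j - \<phi> 0)"
        using R mono by (simp_all add: strict_mono_less)
      then have "\<not> list_emb R (tl (g (\<phi> (i - \<phi> 0)))) (tl (g (\<phi> (j - \<phi> 0))))"
        using list_emb_Cons2[of R "hd (g (\<phi> (i - \<phi> 0)))"] g_bad by (metis g_Cons)
      then show ?thesis using 3 \<open>i < j\<close> by (simp add: h_def)
    qed
  qed
  then have "length (g (\<phi> 0)) \<le> length (h (\<phi> 0))"
    by (rule g_min) (simp add: h_def)
  also have "\<dots> < length (g (\<phi> 0))" using g_ne by (simp add: h_def)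
  finally show False by simp
qed

subsection \<open>Finitely generated monoids\<close>

lemma additive_monoid_generated: "additive_monoid (generated_monoid X)"
  unfolding generated_monoid_def
  by (rule hull_in) (auto simp: additive_monoid_def)

lemma generated_monoid_zero: "0 \<in> generated_monoid X"
  and generated_monoid_add: "x \<in> generated_monoid X \<Longrightarrow> y \<in> generated_monoid X \<Longrightarrow> x + y \<in> generated_monoid X"
  using additive_monoid_generated[of X] by (auto simp: additive_monoid_def)

lemma generated_monoid_inc: "x \<in> X \<Longrightarrow> x \<in> generated_monoid X"
  unfolding generated_monoid_def by (rule hull_inc)

lemma generated_monoid_minimal: "X \<subseteq> M \<Longrightarrow> additive_monoid M \<Longrightarrow> generated_monoid X \<subseteq> M"
  unfolding generated_monoid_def by (rule hull_minimal)

lemma generated_monoid_induct [consumes 1, case_names inc zero add]: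
  assumes "a \<in> generated_monoid X" "\<And>x. x \<in> X \<Longrightarrow> P x" "P 0" "\<And>x y. P x \<Longrightarrow> P y \<Longrightarrow> P (x + y)"
  shows "P a"
  using generated_monoid_minimal[of X "Collect P"] assms by (auto simp: additive_monoid_def)

lemma additive_monoid_sum_mset:
  "additive_monoid M \<Longrightarrow> set_mset N \<subseteq> M \<Longrightarrow> sum_mset N \<in> M"
  by (induction N) (auto simp: additive_monoid_def)

text \<open>Multisets of generators act as vectors of coefficients; through them questions about the
  monoid reduce to Dickson's lemma.\<close>

lemma generated_monoid_mset:
  "generated_monoid (P :: 'a::comm_monoid_add set) = sum_mset ` {M. set_mset M \<subseteq> P}"
proof
  show "generated_monoid P \<subseteq> sum_mset ` {M. set_mset M \<subseteq> P}"
  proof (rule generated_monoid_minimal)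
    show "P \<subseteq> sum_mset ` {M. set_mset M \<subseteq> P}"
      by (auto intro!: image_eqI[where x = "{#_#}"])
    have "0 \<in> sum_mset ` {M. set_mset M \<subseteq> P}"
      by (rule image_eqI[where x = "{#}"]) auto
    moreover have "sum_mset M + sum_mset N \<in> sum_mset ` {M. set_mset M \<subseteq> P}"
      if "set_mset M \<subseteq> P" "set_mset N \<subseteq> P" for M N
      by (rule image_eqI[where x = "M + N"]) (use that in auto)
    ultimately show "additive_monoid (sum_mset ` {M. set_mset M \<subseteq> P})"
      by (auto simp: additive_monoid_def)
  qed
  show "sum_mset ` {M. set_mset M \<subseteq> P} \<subseteq> generated_monoid P"
    using additive_monoid_sum_mset[OF additive_monoid_generated[of P]] generated_monoid_inc by blast
qed

lemma fin_gen_monoid_additive: "fin_gen_monoid M \<Longrightarrow> additive_monoid M"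
  unfolding fin_gen_monoid_def using additive_monoid_generated by blast

lemma fin_gen_monoid_generated: "finite P \<Longrightarrow> fin_gen_monoid (generated_monoid P)"
  unfolding fin_gen_monoid_def by blast

text \<open>If one multiset of generators contains another, the difference of their sums is again a
  sum of generators, and the offset \<open>b\<close> cancels.\<close>

lemma wqo_fin_gen_monoid:
  fixes M :: "'a::ab_group_add set"
  assumes "fin_gen_monoid M"
  shows "wqo (\<lambda>x y. y - x \<in> M) ((+) b ` M)"
proof -
  obtain P where P: "finite P" "M = generated_monoid P"
    using assms unfolding fin_gen_monoid_def by blast
  have "(+) b ` M = (\<lambda>N. b + sum_mset N) ` {N. set_mset N \<subseteq> P}"
    unfolding P generated_monoid_mset by (simp add: image_image)
  moreover have "wqo (\<lambda>x y. y - x \<in> M) \<dots>"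
  proof (rule wqo_image[OF wqo_mset[OF P(1)]])
    fix N N' assume N: "N' \<in> {N. set_mset N \<subseteq> P}" "N \<subseteq># N'"
    then have "b + sum_mset N' - (b + sum_mset N) = sum_mset (N' - N)"
      by (simp add: sum_mset_diff)
    moreover have "set_mset (N' - N) \<subseteq> P" using N by (auto dest: in_diffD)
    ultimately show "b + sum_mset N' - (b + sum_mset N) \<in> M"
      unfolding P generated_monoid_mset by auto
  qed
  ultimately show ?thesis by simp
qed

lemma sum_mset_additive:
  fixes f :: "'a::comm_monoid_add \<Rightarrow> 'b::ab_group_add"
  assumes "\<And>x y. f (x + y) = f x + f y"
  shows "f (sum_mset M) = sum_mset (image_mset f M)"
proof (induction M)
  case empty
  have "f 0 + f 0 = f 0 + 0" using assms[of 0 0] by simp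
  then show ?case unfolding add_left_cancel by simp
qed (simp add: assms)

lemma fin_gen_monoid_image:
  fixes f :: "'a::comm_monoid_add \<Rightarrow> 'b::ab_group_add"
  assumes "\<And>x y. f (x + y) = f x + f y" "fin_gen_monoid M"
  shows "fin_gen_monoid (f ` M)"
proof -
  obtain P where P: "finite P" "M = generated_monoid P"
    using assms(2) unfolding fin_gen_monoid_def by blast
  have "f ` M = generated_monoid (f ` P)"
  proof
    show "f ` M \<subseteq> generated_monoid (f ` P)"
      unfolding P generated_monoid_mset using sum_mset_additive[of f, OF assms(1)]
      by (force intro!: image_eqI[where x = "image_mset f _"])
    show "generated_monoid (f ` P) \<subseteq> f ` M"
    proof (rule generated_monoid_minimal)
      show "f ` P \<subseteq> f ` M" using P generated_monoid_inc by blast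
      have "f 0 = 0" using sum_mset_additive[of f "{#}", OF assms(1)] by simp
      then show "additive_monoid (f ` M)"
        using additive_monoid_generated[of P] unfolding P(2) additive_monoid_def
        by (auto simp: assms(1)[symmetric] intro!: image_eqI[of 0 f 0])
    qed
  qed
  then show ?thesis using P(1) unfolding fin_gen_monoid_def by blast
qed

text \<open>Pairs of multisets of generators solving \<open>f (sum M) = sum N\<close> are closed under subtraction of a
  smaller pair, hence generated by the finitely many minimal ones (Gordan's lemma).\<close>

lemma fin_gen_monoid_preimage:
  fixes f :: "'a::ab_group_add \<Rightarrow> 'b::ab_group_add"
  assumes add: "\<And>x y. f (x + y) = f x + f y" and A: "fin_gen_monoid A" and B: "fin_gen_monoid B"
  shows "fin_gen_monoid {a \<in> A. f a \<in> B}"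
proof -
  obtain P where P: "finite P" "A = generated_monoid P"
    using A unfolding fin_gen_monoid_def by blast
  obtain Q where Q: "finite Q" "B = generated_monoid Q"
    using B unfolding fin_gen_monoid_def by blast
  define K where "K = {(M, N). set_mset M \<subseteq> P \<and> set_mset N \<subseteq> Q \<and> f (sum_mset M) = sum_mset N}"
  \<comment> \<open>Without the trivial pair every basis element is nonempty, so that subtracting
    one strictly decreases the total size.\<close>
  have "wqo (\<lambda>(M, N) (M', N'). M \<subseteq># M' \<and> N \<subseteq># N') (K - {({#}, {#})})"
  proof -
    have "wqo (\<lambda>x y. fst x \<subseteq># fst y) K"
      by (rule wqo_inv_image[OF wqo_mset[OF P(1)], where h = fst]) (auto simp: K_def)
    moreover have "wqo (\<lambda>x y. snd x \<subseteq># snd y) K"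
      by (rule wqo_inv_image[OF wqo_mset[OF Q(1)], where h = snd]) (auto simp: K_def)
    ultimately have "wqo (\<lambda>x y. fst x \<subseteq># fst y \<and> snd x \<subseteq># snd y) K"
      by (rule wqo_conj)
    then have "wqo (\<lambda>(M, N) (M', N'). M \<subseteq># M' \<and> N \<subseteq># N') K"
      by (rule wqo_inv_image[where h = id]) auto
    then show ?thesis by (rule wqo_subset) auto
  qed
  then obtain G where G: "finite G" "G \<subseteq> K - {({#}, {#})}"
    and basis: "\<And>x. x \<in> K - {({#}, {#})} \<Longrightarrow>
      \<exists>b\<in>G. b = x \<or> (case b of (M, N) \<Rightarrow> \<lambda>(M', N'). M \<subseteq># M' \<and> N \<subseteq># N') x"
    by (rule wqo_finite_basis) blast
  let ?G = "(\<lambda>(M, N). sum_mset M) ` G"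
  have gen: "sum_mset M \<in> generated_monoid ?G" if "(M, N) \<in> K" for M N
    using that
  proof (induction "size M + size N" arbitrary: M N rule: less_induct)
    case less
    show ?case
    proof (cases "(M, N) = ({#}, {#})")
      case True
      then show ?thesis by (simp add: generated_monoid_zero)
    next
      case False
      with less.prems basis[of "(M, N)"] obtain M0 N0
        where 0: "(M0, N0) \<in> G" "M0 \<subseteq># M" "N0 \<subseteq># N" by force
      then have K0: "(M0, N0) \<in> K" "(M0, N0) \<noteq> ({#}, {#})" using G by auto
      have "f (sum_mset M) = f (sum_mset (M - M0)) + f (sum_mset M0)"
        unfolding add[symmetric] using 0(2) by (simp add: sum_mset_diff)
      then have "(M - M0, N - N0) \<in> K"
        using 0 K0(1) less.prems unfolding K_def
        by (auto simp: sum_mset_diff eq_diff_eq dest: in_diffD)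
      moreover have "size (M - M0) + size (N - N0) < size M + size N"
      proof -
        have "0 < size M0 + size N0"
          using K0(2) by (auto simp: nonempty_has_size)
        then show ?thesis
          using 0(2,3) size_mset_mono[OF 0(2)] size_mset_mono[OF 0(3)]
          by (simp add: size_Diff_submset) linarith
      qed
      ultimately have "sum_mset (M - M0) \<in> generated_monoid ?G" using less.hyps by blast
      moreover have "sum_mset M0 \<in> generated_monoid ?G"
        using 0(1) by (intro generated_monoid_inc) force
      moreover have "sum_mset M = sum_mset (M - M0) + sum_mset M0"
        using 0(2) by (simp add: sum_mset_diff)
      ultimately show ?thesis by (simp add: generated_monoid_add)
    qed
  qed
  have "{a \<in> A. f a \<in> B} = generated_monoid ?G"
  proof
    show "{a \<in> A. f a \<in> B} \<subseteq> generated_monoid ?G"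
    proof clarify
      fix a assume "a \<in> A" "f a \<in> B"
      then obtain M N where "set_mset M \<subseteq> P" "a = sum_mset M" "set_mset N \<subseteq> Q" "f a = sum_mset N"
        unfolding P Q generated_monoid_mset by auto
      then show "a \<in> generated_monoid ?G" using gen[of M N] unfolding K_def by auto
    qed
    show "generated_monoid ?G \<subseteq> {a \<in> A. f a \<in> B}"
    proof (rule generated_monoid_minimal)
      show "?G \<subseteq> {a \<in> A. f a \<in> B}"
        using G(2) unfolding K_def P Q generated_monoid_mset by force
      have "f 0 = 0" using sum_mset_additive[of f "{#}", OF add] by simp
      then show "additive_monoid {a \<in> A. f a \<in> B}"
        using fin_gen_monoid_additive[OF A] fin_gen_monoid_additive[OF B] add
        by (auto simp: additive_monoid_def)
    qed
  qed
  then show ?thesis using G(1) unfolding fin_gen_monoid_def by blast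
qed

lemma fin_gen_monoid_nonneg_vecs:
  assumes "finite I"
  shows "fin_gen_monoid (nonneg_vecs I :: ('i \<Rightarrow> int) set)" (is "fin_gen_monoid ?A")
proof -
  define e :: "'i \<Rightarrow> 'i \<Rightarrow> int" where "e = (\<lambda>i j. if j = i then 1 else 0)"
  have "x \<in> generated_monoid (e ` I)" if "x \<in> ?A" for x
    using that
  proof (induction "nat (\<Sum>i\<in>I. x i)" arbitrary: x rule: less_induct)
    case less
    show ?case
    proof (cases "\<forall>i\<in>I. x i = 0")
      case True
      then have "x = 0" using less.prems by (auto simp: nonneg_vecs_def fun_eq_iff)
      then show ?thesis by (simp add: generated_monoid_zero)
    next
      case False
      then obtain i where i: "i \<in> I" "x i \<noteq> 0" by blast
      with less.prems have pos: "0 < x i" by (auto simp: nonneg_vecs_def le_fun_def order_less_le)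
      have mem: "x - e i \<in> ?A" using less.prems i pos by (auto simp: nonneg_vecs_def le_fun_def e_def)
      have "(\<Sum>j\<in>I. (x - e i) j) = (\<Sum>j\<in>I. x j) - 1"
        using i assms by (simp add: sum_subtractf e_def)
      moreover have "0 < (\<Sum>j\<in>I. x j)"
        using assms i pos less.prems by (intro sum_pos2[of I i]) (auto simp: nonneg_vecs_def le_fun_def)
      ultimately have "x - e i \<in> generated_monoid (e ` I)"
        by (intro less.hyps mem) simp
      then have "(x - e i) + e i \<in> generated_monoid (e ` I)"
        using i by (intro generated_monoid_add) (auto intro: generated_monoid_inc)
      then show ?thesis by simp
    qed
  qed
  moreover have "generated_monoid (e ` I) \<subseteq> ?A"
    by (rule generated_monoid_minimal) (auto simp: nonneg_vecs_def e_def le_fun_def additive_monoid_def)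
  ultimately have "?A = generated_monoid (e ` I)" by blast
  then show ?thesis using assms unfolding fin_gen_monoid_def by blast
qed

subsection \<open>Reachability\<close>

text \<open>As simp rules these would also rewrite eta-expanded vectors, such as \<open>\<lambda>i. (x + y) i\<close>.\<close>

lemmas vec_apply = plus_fun_apply minus_apply zero_fun_apply one_fun_apply times_fun_apply of_nat_fun_apply
declare plus_fun_apply [simp del] minus_apply [simp del] zero_fun_apply [simp del]
  times_fun_apply [simp del] one_fun_apply [simp del] of_nat_fun_apply [simp del]

text \<open>An action is represented by its displacement alone. The closure \<open>reach\<close> is
  reflexive even at vectors with negative entries, hence the assumption \<open>0 \<le> x\<close> in
  \<open>reach_nonneg\<close>.\<close>

definition vstep :: "('i \<Rightarrow> int) set \<Rightarrow> ('i \<Rightarrow> int) \<Rightarrow> ('i \<Rightarrow> int) \<Rightarrow> bool" where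
  "vstep A x y \<longleftrightarrow> 0 \<le> x \<and> 0 \<le> y \<and> y - x \<in> A"

abbreviation reach :: "('i \<Rightarrow> int) set \<Rightarrow> ('i \<Rightarrow> int) \<Rightarrow> ('i \<Rightarrow> int) \<Rightarrow> bool" where
  "reach A \<equiv> (vstep A)\<^sup>*\<^sup>*"

text \<open>Monotonicity of vector addition systems: a nonnegative surplus changes no displacement
  and keeps all configurations nonnegative. All pumping rests on this.\<close>

lemma reach_add: "reach A x y \<Longrightarrow> 0 \<le> u \<Longrightarrow> reach A (x + u) (y + u)"
proof (induction rule: rtranclp_induct)
  case (step y z)
  then have "vstep A (y + u) (z + u)" unfolding vstep_def by (simp add: add_nonneg_nonneg)
  with step show ?case by auto
qed auto

lemma reach_nonneg: "reach A x y \<Longrightarrow> 0 \<le> x \<Longrightarrow> 0 \<le> y"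
  by (induction rule: rtranclp_induct) (auto simp: vstep_def)

lemma reach_zero_off:
  "reach A x y \<Longrightarrow> (\<And>a. a \<in> A \<Longrightarrow> a i = 0) \<Longrightarrow> y i = x i"
proof (induction rule: rtranclp_induct)
  case (step y z)
  then have "(z - y) i = 0" by (auto simp: vstep_def)
  with step show ?case by (simp add: vec_apply)
qed simp

section \<open>Closed walks in the graph that ignores the counters in \<open>J\<close>\<close>

definition drop_on :: "'i set \<Rightarrow> ('i \<Rightarrow> int) \<Rightarrow> 'i \<Rightarrow> int" where
  "drop_on J x = (\<lambda>i. if i \<in> J then 0 else x i)"

lemma drop_on_add: "drop_on J (x + y) = drop_on J x + drop_on J y"
  and drop_on_diff: "drop_on J (x - y) = drop_on J x - drop_on J y"
  and drop_on_zero: "drop_on J 0 = 0"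
  by (auto simp: drop_on_def fun_eq_iff vec_apply)

lemma drop_on_nonneg_vecs: "x \<in> nonneg_vecs J \<Longrightarrow> drop_on J x = 0"
  by (auto simp: drop_on_def nonneg_vecs_def fun_eq_iff vec_apply)

text \<open>In the graph with vertex set \<open>G\<close> an edge moves by the projected
  displacement but is labelled with the full one, so that \<open>sum_list w\<close> still records
  the effect on the counters in \<open>J\<close>.\<close>

fun walk :: "('i \<Rightarrow> int) set \<Rightarrow> 'i set \<Rightarrow> ('i \<Rightarrow> int) set \<Rightarrow> ('i \<Rightarrow> int) \<Rightarrow> ('i \<Rightarrow> int) list \<Rightarrow> bool" where
  "walk A J G p [] \<longleftrightarrow> p \<in> G"
| "walk A J G p (a # w) \<longleftrightarrow> p \<in> G \<and> a \<in> A \<and> walk A J G (p + drop_on J a) w"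

lemma walk_append:
  "walk A J G p (v @ w) \<longleftrightarrow> walk A J G p v \<and> walk A J G (p + drop_on J (sum_list v)) w"
proof (induction v arbitrary: p)
  case Nil
  then show ?case by (cases w) (auto simp: drop_on_zero)
qed (auto simp: drop_on_add add.assoc)

lemma walk_alphabet: "walk A J G p w \<Longrightarrow> set w \<subseteq> A"
  by (induction w arbitrary: p) auto

definition closed_walk where
  "closed_walk A J G p w \<longleftrightarrow> walk A J G p w \<and> drop_on J (sum_list w) = 0"

definition cycle_sums where
  "cycle_sums A J G = {sum_list w | w p. closed_walk A J G p w}"

text \<open>A closed walk with more edges than there are vertices splits into two shorter ones.\<close>

lemma fin_gen_cycle_sums:
  assumes A: "finite A" and G: "finite G"
  shows "fin_gen_monoid (generated_monoid (cycle_sums A J G))"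
proof -
  define C where "C = {sum_list w | w p. closed_walk A J G p w \<and> length w \<le> card G}"
  have "C \<subseteq> sum_list ` {w. set w \<subseteq> A \<and> length w \<le> card G}"
    unfolding C_def closed_walk_def using walk_alphabet by blast
  then have fin: "finite C"
    using finite_lists_length_le[OF A] finite_subset by blast
  have short: "sum_list w \<in> generated_monoid C" if "closed_walk A J G p w" for p w
    using that
  proof (induction "length w" arbitrary: p w rule: less_induct)
    case less
    show ?case
    proof (cases "length w \<le> card G")
      case True
      then show ?thesis using less.prems unfolding C_def by (blast intro: generated_monoid_inc)
    next
      case False
      let ?v = "\<lambda>j. p + drop_on J (sum_list (take j w))"
      have walk: "walk A J G p w" and closed: "drop_on J (sum_list w) = 0"
        using less.prems by (auto simp: closed_walk_def)
      have "?v j \<in> G" for j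
      proof -
        have "walk A J G (?v j) (drop j w)"
          using walk walk_append[of A J G p "take j w" "drop j w"] by simp
        then show ?thesis by (cases "drop j w") auto
      qed
      then have "card (?v ` {..<length w}) \<le> card G"
        by (intro card_mono G) auto
      then have "\<not> inj_on ?v {..<length w}"
        using False card_image by fastforce
      then obtain j l where jl: "j < l" "l < length w" and eq: "?v j = ?v l"
        unfolding inj_on_def by (metis lessThan_iff linorder_neqE_nat)
      \<comment> \<open>The positions \<open>j < l < length w\<close> share a vertex, so
        \<open>y\<close> is a loop. It is shorter than \<open>w\<close> because the last position
        was excluded, and \<open>x @ z\<close> is shorter because \<open>j < l\<close>.\<close>
      define x y z where "x = take j w" and "y = drop j (take l w)" and "z = drop l w"
      have w: "w = x @ y @ z" "take l w = x @ y"
      proof -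
        show "take l w = x @ y"
          using jl append_take_drop_id[of j "take l w"] by (simp add: x_def y_def)
        then show "w = x @ y @ z"
          using append_take_drop_id[of l w] by (simp add: z_def)
      qed
      have y0: "drop_on J (sum_list y) = 0"
        using eq w(2) by (simp add: x_def[symmetric] drop_on_add)
      have "walk A J G p x" "walk A J G (?v j) y" "walk A J G (?v j) z"
        using walk y0 unfolding w(1) walk_append by (auto simp: drop_on_add x_def[symmetric] w(1)[symmetric])
      moreover have "drop_on J (sum_list x) + drop_on J (sum_list z) = 0"
        using closed y0 unfolding w(1) by (simp add: drop_on_add)
      ultimately have "closed_walk A J G (?v j) y" "closed_walk A J G p (x @ z)"
        using y0 unfolding closed_walk_def walk_append by (auto simp: drop_on_add x_def)
      moreover have "length y < length w" "length (x @ z) < length w"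
        using jl by (auto simp: x_def y_def z_def)
      ultimately have "sum_list y + sum_list (x @ z) \<in> generated_monoid C"
        using less.hyps by (intro generated_monoid_add) blast+
      then show ?thesis unfolding w(1) by (simp add: algebra_simps)
    qed
  qed
  have "generated_monoid (cycle_sums A J G) = generated_monoid C"
  proof
    show "generated_monoid (cycle_sums A J G) \<subseteq> generated_monoid C"
      using short by (intro generated_monoid_minimal additive_monoid_generated) (auto simp: cycle_sums_def)
    show "generated_monoid C \<subseteq> generated_monoid (cycle_sums A J G)"
      by (intro generated_monoid_minimal additive_monoid_generated)
        (auto simp: cycle_sums_def C_def intro!: generated_monoid_inc)
  qed
  then show ?thesis using fin fin_gen_monoid_generated by metis
qed

definition visits where
  "visits J p w q \<longleftrightarrow> (\<exists>x y. w = x @ y \<and> p + drop_on J (sum_list x) = q)"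

lemma visits_prefix: "visits J p v q \<Longrightarrow> visits J p (v @ w) q"
  unfolding visits_def by (metis append.assoc)

lemma visits_suffix:
  "visits J p w q \<Longrightarrow> drop_on J (sum_list v) = 0 \<Longrightarrow> visits J p (v @ w) q"
  unfolding visits_def by (metis (no_types, lifting) add_0 append.assoc drop_on_add sum_list_append)

definition tour where
  "tour A J G p w \<longleftrightarrow> closed_walk A J G p w \<and> (\<forall>q\<in>G. visits J p w q)"

text \<open>A tour passes through the start of any cycle, where the cycle can be spliced in. The
  enlarged walk still visits every vertex, so further cycles can follow.\<close>

lemma tour_insert:
  assumes "d \<in> generated_monoid (cycle_sums A J G)" "tour A J G p w"
  obtains w' where "tour A J G p w'" "sum_list w' = sum_list w + d"
proof -
  have "\<forall>w. tour A J G p w \<longrightarrow> (\<exists>w'. tour A J G p w' \<and> sum_list w' = sum_list w + d)"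
    using assms(1)
  proof (induction rule: generated_monoid_induct)
    case (inc d)
    then obtain v q where v: "closed_walk A J G q v" "d = sum_list v"
      unfolding cycle_sums_def by blast
    show ?case
    proof (intro allI impI)
      fix w assume w: "tour A J G p w"
      have "q \<in> G" using v(1) by (cases v) (auto simp: closed_walk_def)
      then obtain x y where xy: "w = x @ y" "p + drop_on J (sum_list x) = q"
        using w unfolding tour_def visits_def by blast
      have v0: "drop_on J (sum_list v) = 0" using v(1) by (simp add: closed_walk_def)
      have "closed_walk A J G p (x @ v @ y)"
        using w v(1) v0 unfolding tour_def closed_walk_def xy(1) walk_append
        by (simp add: xy(2) drop_on_add add.assoc[symmetric])
      moreover have "visits J p (x @ v @ y) r" if "visits J p w r" for r
      proof -
        from that obtain s t where st: "w = s @ t" "p + drop_on J (sum_list s) = r"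
          unfolding visits_def by blast
        then have "x @ y = s @ t" using xy(1) by simp
        \<comment> \<open>A visit of the old tour lies before the splice, or after it, where
          inserting the loop \<open>v\<close> does not change the projection.\<close>
        then obtain u where "x = s @ u \<or> s = x @ u \<and> y = u @ t"
          by (auto simp: append_eq_append_conv2)
        then show ?thesis
        proof
          assume "x = s @ u"
          then show ?thesis using st(2) unfolding visits_def
            by (intro exI[of _ s] exI[of _ "u @ v @ y"]) simp
        next
          assume u: "s = x @ u \<and> y = u @ t"
          then have "p + drop_on J (sum_list (x @ v @ u)) = r"
            using st(2) v0 by (simp add: drop_on_add)
          then show ?thesis using u unfolding visits_def
            by (intro exI[of _ "x @ v @ u"] exI[of _ t]) simp
        qed
      qed
      ultimately have "tour A J G p (x @ v @ y)" using w by (auto simp: tour_def)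
      moreover have "sum_list (x @ v @ y) = sum_list w + d"
        by (simp add: xy(1) v(2) algebra_simps)
      ultimately show "\<exists>w'. tour A J G p w' \<and> sum_list w' = sum_list w + d" by blast
    qed
  next
    case zero
    then show ?case by auto
  next
    case (add d e)
    then show ?case by (metis add.assoc)
  qed
  with assms(2) that show thesis by blast
qed

section \<open>Passing between walks and executable paths\<close>

text \<open>Outside \<open>J\<close> the intermediate configurations are nonnegative because they
  project to vertices of \<open>G\<close>; inside \<open>J\<close> the supply covers all that the
  rest of the walk can remove.\<close>

lemma walk_fire:
  assumes "finite J" "\<And>q i. q \<in> G \<Longrightarrow> i \<notin> J \<Longrightarrow> 0 \<le> q i"
    and "walk A J G (drop_on J x) w" "0 \<le> x"
    and "\<And>i. i \<in> J \<Longrightarrow> (\<Sum>a\<leftarrow>w. \<Sum>j\<in>J. \<bar>a j\<bar>) \<le> x i"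
  shows "reach A x (x + sum_list w)"
  using assms(3-)
proof (induction w arbitrary: x)
  case Nil
  then show ?case by simp
next
  case (Cons a w)
  have w: "walk A J G (drop_on J (x + a)) w" and a: "a \<in> A"
    using Cons.prems(1) by (auto simp: drop_on_add)
  have bound: "(\<Sum>a\<leftarrow>w. \<Sum>j\<in>J. \<bar>a j\<bar>) \<le> (x + a) i" if "i \<in> J" for i
  proof -
    have "\<bar>a i\<bar> \<le> (\<Sum>j\<in>J. \<bar>a j\<bar>)"
      using that assms(1) by (intro member_le_sum) auto
    then show ?thesis using Cons.prems(3)[OF that] by (simp add: vec_apply)
  qed
  have "drop_on J (x + a) \<in> G" using w by (cases w) auto
  then have "0 \<le> (x + a) i" if "i \<notin> J" for i
    using assms(2)[of "drop_on J (x + a)" i] that by (simp add: drop_on_def vec_apply)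
  moreover have "0 \<le> (x + a) i" if "i \<in> J" for i
  proof -
    have "0 \<le> (\<Sum>a\<leftarrow>w. \<Sum>j\<in>J. \<bar>a j\<bar>)" by (rule sum_list_nonneg) (auto intro: sum_nonneg)
    also note bound[OF that]
    finally show ?thesis .
  qed
  ultimately have nonneg: "0 \<le> x + a" unfolding le_fun_def by (metis zero_fun_apply)
  then have "vstep A x (x + a)" using Cons.prems(2) a by (simp add: vstep_def)
  moreover have "reach A (x + a) (x + a + sum_list w)"
    using Cons.IH[OF w nonneg bound] .
  ultimately show ?case by (simp add: add.assoc converse_rtranclp_into_rtranclp)
qed

text \<open>The counters in \<open>J\<close> stay at least as large as in \<open>x\<close>, because \<open>r\<close> is
  consumed from, and \<open>s\<close> returned to, an extra supply.\<close>

lemma closed_walk_fire_iterate: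
  fixes x r s :: "'i \<Rightarrow> int"
  assumes J: "finite J" and G: "\<And>q i. q \<in> G \<Longrightarrow> i \<notin> J \<Longrightarrow> 0 \<le> q i"
    and w: "closed_walk A J G (drop_on J x) w" and x: "0 \<le> x"
    and bound: "\<And>i. i \<in> J \<Longrightarrow> (\<Sum>a\<leftarrow>w. \<Sum>j\<in>J. \<bar>a j\<bar>) \<le> x i"
    and rs: "r \<in> nonneg_vecs J" "s \<in> nonneg_vecs J" "s - r = sum_list w"
  shows "reach A (x + of_nat k * r) (x + of_nat k * s)"
proof (induction k)
  case 0
  then show ?case by simp
next
  case (Suc k)
  have r: "0 \<le> r" and s: "0 \<le> s" using rs by (auto simp: nonneg_vecs_def)
  have ks: "0 \<le> of_nat k * s" using s by (simp add: le_fun_def vec_apply)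
  \<comment> \<open>The induction hypothesis, with one \<open>r\<close> set aside, leads to
    \<open>?y\<close>; one more execution of \<open>w\<close> turns that \<open>r\<close> into
    \<open>s\<close>.\<close>
  let ?y = "x + of_nat k * s + r"
  have "drop_on J ?y = drop_on J x"
    using rs by (auto simp: drop_on_def nonneg_vecs_def fun_eq_iff vec_apply)
  then have "walk A J G (drop_on J ?y) w" using w by (simp add: closed_walk_def)
  moreover have "0 \<le> ?y" using x r ks by simp
  moreover have "\<forall>i\<in>J. (\<Sum>a\<leftarrow>w. \<Sum>j\<in>J. \<bar>a j\<bar>) \<le> ?y i"
  proof
    fix i assume "i \<in> J"
    then show "(\<Sum>a\<leftarrow>w. \<Sum>j\<in>J. \<bar>a j\<bar>) \<le> ?y i"
      using bound[of i] le_funD[OF ks, of i] le_funD[OF r, of i] by (simp add: vec_apply)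
  qed
  ultimately have "reach A ?y (?y + sum_list w)"
    using walk_fire[where J = J and G = G and x = ?y and w = w] J G by blast
  moreover have "?y + sum_list w = x + of_nat (Suc k) * s"
    unfolding rs(3)[symmetric] by (simp add: algebra_simps)
  moreover have "reach A (x + of_nat (Suc k) * r) ?y"
    using reach_add[OF Suc r] by (simp add: algebra_simps)
  ultimately show ?case by (metis rtranclp_trans)
qed

lemma reach_walk:
  assumes "reach A x y" "\<And>q. reach A x q \<Longrightarrow> reach A q y \<Longrightarrow> drop_on J q \<in> G"
  obtains w where "walk A J G (drop_on J x) w" "y = x + sum_list w"
proof -
  have "\<exists>w. walk A J G (drop_on J x) w \<and> y = x + sum_list w"
    using assms
  proof (induction rule: converse_rtranclp_induct)
    case base
    then have "drop_on J y \<in> G" by blast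
    then show ?case by (intro exI[of _ "[]"]) auto
  next
    case (step x x')
    then obtain w where "walk A J G (drop_on J x') w" "y = x' + sum_list w"
      by (meson converse_rtranclp_into_rtranclp)
    moreover have "drop_on J x \<in> G"
      using step.hyps step.prems by (meson converse_rtranclp_into_rtranclp rtranclp.rtrancl_refl)
    moreover have "drop_on J x' = drop_on J x + drop_on J (x' - x)" by (simp add: drop_on_diff)
    ultimately show ?case
      using step.hyps(1) by (intro exI[of _ "(x' - x) # w"]) (auto simp: vstep_def)
  qed
  with that show thesis by blast
qed

subsection \<open>Transformer relations\<close>

lemma additive_monoid_scale:
  fixes x :: "'e \<Rightarrow> int"
  assumes "additive_monoid M" "x \<in> M"
  shows "of_nat k * x \<in> M"
proof (induction k)
  case 0
  then show ?case using assms(1) by (simp add: additive_monoid_def)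
next
  case (Suc k)
  then show ?case using assms by (simp add: additive_monoid_def distrib_right)
qed

lemma additive_scale:
  fixes f :: "('e \<Rightarrow> int) \<Rightarrow> 'i \<Rightarrow> int"
  assumes "\<And>x y. f (x + y) = f x + f y"
  shows "f (of_nat k * x) = of_nat k * f x"
proof (induction k)
  case 0
  have "f 0 + f 0 = f 0 + 0" using assms[of 0 0] by simp
  then show ?case unfolding add_left_cancel by simp
qed (simp add: assms distrib_right)

lemma scale_nonneg: "0 \<le> x \<Longrightarrow> 0 \<le> of_nat k * (x :: 'e \<Rightarrow> int)"
  by (auto simp: le_fun_def vec_apply)

text \<open>\<open>f x\<close> and \<open>g x\<close> are what is added to the configuration \<open>c\<close> at the source and at the target.\<close>

locale transformer =
  fixes A :: "('i \<Rightarrow> int) set" and I :: "'i set" and c :: "'i \<Rightarrow> int"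
    and X :: "('e \<Rightarrow> int) set" and f g :: "('e \<Rightarrow> int) \<Rightarrow> 'i \<Rightarrow> int"
  assumes finite_A: "finite A" and finite_I: "finite I"
    and A_off: "\<And>a i. a \<in> A \<Longrightarrow> i \<notin> I \<Longrightarrow> a i = 0"
    and c: "c \<in> nonneg_vecs I"
    and f_add: "\<And>x y. f (x + y) = f x + f y" and g_add: "\<And>x y. g (x + y) = g x + g y"
    and X: "fin_gen_monoid X"
    and f_X: "\<And>x. x \<in> X \<Longrightarrow> f x \<in> nonneg_vecs I" and g_X: "\<And>x. x \<in> X \<Longrightarrow> g x \<in> nonneg_vecs I"
begin

definition Z where "Z = {x \<in> X. reach A (c + f x) (c + g x)}"

definition visited where
  "visited = {q. \<exists>x\<in>Z. reach A (c + f x) q \<and> reach A q (c + g x)}"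

text \<open>An intraproduction: \<open>h\<close> is the surplus over \<open>c\<close> at an
  intermediate configuration that lies above \<open>c\<close>.\<close>

definition intra where
  "intra x h \<longleftrightarrow> x \<in> Z \<and> 0 \<le> h \<and> reach A (c + f x) (c + h) \<and> reach A (c + h) (c + g x)"

definition J where "J = {i. \<exists>x h. intra x h \<and> 0 < h i}"

abbreviation "G \<equiv> drop_on J ` visited"

definition W where
  "W = {x \<in> X. f x \<in> nonneg_vecs J \<and> g x \<in> nonneg_vecs J \<and>
         g x - f x \<in> generated_monoid (cycle_sums A J G)}"

section \<open>Intraproductions and the finite graph\<close>

lemma c_nonneg: "0 \<le> c"
  using c by (simp add: nonneg_vecs_def)

lemma f_nonneg: "x \<in> X \<Longrightarrow> 0 \<le> f x" and g_nonneg: "x \<in> X \<Longrightarrow> 0 \<le> g x"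
  using f_X g_X by (auto simp: nonneg_vecs_def)

lemma f_zero: "f 0 = 0" and g_zero: "g 0 = 0"
  using f_add[of 0 0] g_add[of 0 0] by (metis add_cancel_right_right)+

lemma additive_X: "additive_monoid X"
  using X by (rule fin_gen_monoid_additive)

lemma Z_X: "x \<in> Z \<Longrightarrow> x \<in> X" and Z_reach: "x \<in> Z \<Longrightarrow> reach A (c + f x) (c + g x)"
  by (auto simp: Z_def)

text \<open>Both paths are executed together, each lifted by the surplus of the other: first the two
  first halves, which meet at \<open>c + (h + k)\<close>, then the two second halves.\<close>

lemma intra_add:
  assumes "intra x h" "intra y k"
  shows "intra (x + y) (h + k)"
proof -
  have x: "x \<in> Z" "0 \<le> h" "reach A (c + f x) (c + h)" "reach A (c + h) (c + g x)"
    and y: "y \<in> Z" "0 \<le> k" "reach A (c + f y) (c + k)" "reach A (c + k) (c + g y)"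
    using assms by (auto simp: intra_def)
  have "reach A (c + f x + f y) (c + h + f y)" "reach A (c + h + g y) (c + g x + g y)"
    using x y f_nonneg g_nonneg Z_X by (auto intro: reach_add)
  then have 1: "reach A (c + f (x + y)) (c + f y + h)" "reach A (c + g y + h) (c + g (x + y))"
    by (simp_all add: f_add g_add ac_simps)
  have "reach A (c + f y + h) (c + k + h)" "reach A (c + k + h) (c + g y + h)"
    using x y by (auto intro: reach_add)
  then have 2: "reach A (c + f y + h) (c + (h + k))" "reach A (c + (h + k)) (c + g y + h)"
    by (simp_all add: ac_simps)
  have "reach A (c + f (x + y)) (c + (h + k))" "reach A (c + (h + k)) (c + g (x + y))"
    using 1(1) 2(1) by (rule rtranclp_trans) (rule rtranclp_trans[OF 2(2) 1(2)])
  moreover from this have "reach A (c + f (x + y)) (c + g (x + y))" by (rule rtranclp_trans)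
  moreover have "x + y \<in> X" using x y Z_X additive_X by (simp add: additive_monoid_def)
  ultimately show ?thesis using x(2) y(2) by (simp add: intra_def Z_def)
qed

lemma intra_source: "x \<in> Z \<Longrightarrow> intra x (f x)" and intra_target: "x \<in> Z \<Longrightarrow> intra x (g x)"
  using f_nonneg g_nonneg by (auto simp: intra_def Z_def)

lemma intra_zero: "intra 0 0"
  using additive_X by (simp add: intra_def Z_def f_zero g_zero additive_monoid_def)

lemma additive_Z: "additive_monoid Z"
  using intra_zero intra_add intra_source unfolding additive_monoid_def intra_def by blast

lemma intra_scale: "intra x h \<Longrightarrow> intra (of_nat k * x) (of_nat k * h)"
  by (induction k) (simp_all add: intra_zero intra_add distrib_right)

lemma intra_nonneg_vecs:
  assumes "intra x h"
  shows "h \<in> nonneg_vecs J"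
proof -
  have "0 \<le> h" using assms by (simp add: intra_def)
  then show ?thesis
    using assms unfolding nonneg_vecs_def J_def le_fun_def by (auto simp: zero_fun_apply order_less_le)
qed

lemma visited_nonneg_vecs:
  assumes "q \<in> visited"
  shows "q \<in> nonneg_vecs I"
proof -
  obtain x where x: "x \<in> Z" "reach A (c + f x) q" using assms unfolding visited_def by blast
  then have "0 \<le> q"
    using reach_nonneg c_nonneg f_nonneg Z_X by (metis add_nonneg_nonneg)
  moreover have "q i = 0" if "i \<notin> I" for i
    using reach_zero_off[OF x(2), of i] A_off c f_X[OF Z_X[OF x(1)]] that
    by (simp add: nonneg_vecs_def vec_apply)
  ultimately show ?thesis by (simp add: nonneg_vecs_def)
qed

lemma J_subset: "J \<subseteq> I"
proof
  fix i assume "i \<in> J"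
  then obtain x h where xh: "intra x h" "0 < h i" unfolding J_def by blast
  then have "c + h \<in> visited" unfolding intra_def visited_def by blast
  then have "0 = (c + h) i" if "i \<notin> I"
    using visited_nonneg_vecs that by (auto simp: nonneg_vecs_def)
  moreover have "0 \<le> c i" using c_nonneg by (simp add: le_fun_def zero_fun_apply)
  ultimately show "i \<in> I" using xh(2) by (force simp: vec_apply)
qed

lemma finite_J: "finite J"
  using J_subset finite_I finite_subset by blast

text \<open>The path of \<open>y\<close> is interrupted at \<open>q' = q + (q' - q)\<close>. There
  the second half of the path of \<open>x\<close> is executed, then its first half, which returns to
  \<open>q'\<close>. Between the two stands an intraproduction containing the increase
  \<open>q' - q\<close>.\<close>

lemma visited_increase:
  assumes "q \<in> visited" "q' \<in> visited" "q \<le> q'" "q i < q' i"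
  shows "i \<in> J"
proof -
  obtain x where x: "x \<in> Z" "reach A (c + f x) q" "reach A q (c + g x)"
    using assms(1) unfolding visited_def by blast
  obtain y where y: "y \<in> Z" "reach A (c + f y) q'" "reach A q' (c + g y)"
    using assms(2) unfolding visited_def by blast
  let ?d = "q' - q"
  define h where "h = g x + ?d + f x"
  have d: "0 \<le> ?d" using assms(3) by simp
  have fx: "0 \<le> f x" and gx: "0 \<le> g x" using f_nonneg g_nonneg Z_X x(1) by auto
  have "reach A (c + f y + f x) (q' + f x)" using y fx by (intro reach_add)
  moreover have "reach A (q + (?d + f x)) (c + g x + (?d + f x))" using x d fx by (intro reach_add) auto
  ultimately have 1: "reach A (c + f (y + x)) (c + h)"
    unfolding f_add h_def by (simp add: algebra_simps)
  have "reach A (c + f x + (?d + g x)) (q + (?d + g x))" using x d gx by (intro reach_add) auto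
  moreover have "reach A (q' + g x) (c + g y + g x)" using y gx by (intro reach_add)
  ultimately have 2: "reach A (c + h) (c + g (y + x))"
    unfolding g_add h_def by (simp add: algebra_simps)
  have "0 \<le> h" using d fx gx by (simp add: h_def)
  moreover have "y + x \<in> Z" using additive_Z x y by (simp add: additive_monoid_def)
  ultimately have "intra (y + x) h" using 1 2 by (simp add: intra_def)
  moreover have "0 < h i"
    using assms(4) le_funD[OF fx, of i] le_funD[OF gx, of i] by (simp add: h_def vec_apply)
  ultimately show ?thesis unfolding J_def by blast
qed

text \<open>Among infinitely many visited configurations with distinct projections, Dickson's lemma
  finds two comparable ones; they differ at a counter outside \<open>J\<close>, contrary to
  \<open>visited_increase\<close>.\<close>

lemma finite_G: "finite G"
proof (rule ccontr)
  assume "infinite G"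
  then obtain v :: "nat \<Rightarrow> 'i \<Rightarrow> int" where v: "inj v" "range v \<subseteq> G"
    using infinite_countable_subset by blast
  have "\<exists>q. q \<in> visited \<and> drop_on J q = v n" for n
    using rangeI[of v n, THEN subsetD[OF v(2)]] by auto
  then have "\<exists>q. \<forall>n. q n \<in> visited \<and> drop_on J (q n) = v n" by (intro choice allI)
  then obtain q where q: "\<And>n. q n \<in> visited" "\<And>n. drop_on J (q n) = v n" by blast
  have "\<And>n. q n \<in> nonneg_vecs I" using q(1) visited_nonneg_vecs by blast
  from wqoD[OF wqo_nonneg_vecs[OF finite_I] this]
  obtain i j where ij: "i < j" "q i \<le> q j" by blast
  have "v i \<noteq> v j" using v(1) ij(1) by (metis injD less_irrefl)
  then obtain k where "drop_on J (q i) k \<noteq> drop_on J (q j) k"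
    unfolding q(2) by blast
  then have "k \<notin> J" "q i k \<noteq> q j k" by (auto simp: drop_on_def split: if_splits)
  moreover have "q i k \<le> q j k" using ij(2) by (simp add: le_fun_def)
  ultimately show False using visited_increase[OF q(1) q(1) ij(2)] by fastforce
qed

lemma G_nonneg: "p \<in> G \<Longrightarrow> i \<notin> J \<Longrightarrow> 0 \<le> p i"
  using visited_nonneg_vecs by (auto simp: drop_on_def nonneg_vecs_def le_fun_def zero_fun_apply)

lemma drop_on_start: "intra x h \<Longrightarrow> drop_on J (c + h) = drop_on J c"
  using drop_on_nonneg_vecs[OF intra_nonneg_vecs] by (simp add: drop_on_add)

text \<open>The path is cut at \<open>q\<close> and both parts are projected. The result is closed
  because \<open>f x\<close> and \<open>g x\<close> are supported on \<open>J\<close>, so source and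
  target both project to the vertex of \<open>c\<close>.\<close>

lemma closed_walk_through:
  assumes "x \<in> Z" "reach A (c + f x) q" "reach A q (c + g x)"
  obtains w where "closed_walk A J G (drop_on J c) w" "visits J (drop_on J c) w (drop_on J q)"
    "sum_list w = g x - f x"
proof -
  have "drop_on J r \<in> G" if "reach A (c + f x) r" "reach A r q" for r
    using assms that unfolding visited_def by (blast intro: rtranclp_trans)
  from reach_walk[OF assms(2) this]
  obtain u where u: "walk A J G (drop_on J (c + f x)) u" "q = c + f x + sum_list u" by blast
  have "drop_on J r \<in> G" if "reach A q r" "reach A r (c + g x)" for r
    using assms that unfolding visited_def by (blast intro: rtranclp_trans)
  from reach_walk[OF assms(3) this]
  obtain v where v: "walk A J G (drop_on J q) v" "c + g x = q + sum_list v" by blast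
  have start: "drop_on J (c + f x) = drop_on J c" and target: "drop_on J (c + g x) = drop_on J c"
    using drop_on_start intra_source intra_target assms(1) by auto
  have sum: "sum_list (u @ v) = g x - f x" using u(2) v(2) by (simp add: algebra_simps)
  have q: "drop_on J c + drop_on J (sum_list u) = drop_on J q"
    unfolding u(2) using start by (simp add: drop_on_add)
  have "drop_on J (g x) = 0" "drop_on J (f x) = 0"
    using start target by (simp_all add: drop_on_add)
  then have "closed_walk A J G (drop_on J c) (u @ v)"
    using u(1) v(1) q start sum unfolding closed_walk_def by (simp add: walk_append drop_on_diff)
  moreover have "visits J (drop_on J c) (u @ v) (drop_on J q)"
    using q unfolding visits_def by blast
  ultimately show thesis using that sum by blast
qed

section \<open>The relaxed monoid \<open>W\<close> and pumping\<close>

lemma Z_subset_W: "Z \<subseteq> W"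
proof
  fix x assume x: "x \<in> Z"
  obtain w where "closed_walk A J G (drop_on J c) w" "sum_list w = g x - f x"
    using closed_walk_through[OF x rtranclp.rtrancl_refl Z_reach[OF x]] by blast
  then have "g x - f x \<in> cycle_sums A J G" unfolding cycle_sums_def by (intro CollectI exI[of _ w] exI[of _ "drop_on J c"]) simp
  then show "x \<in> W"
    using intra_nonneg_vecs[OF intra_source[OF x]] intra_nonneg_vecs[OF intra_target[OF x]] x
    unfolding W_def by (auto intro: generated_monoid_inc Z_X)
qed

text \<open>\<open>W\<close> is cut out of \<open>X\<close> by three conditions, each placing an
  additive image in a finitely generated monoid, so Gordan's lemma applies three times.\<close>

lemma fin_gen_W: "fin_gen_monoid W"
proof -
  have nn: "fin_gen_monoid (nonneg_vecs J)" by (rule fin_gen_monoid_nonneg_vecs[OF finite_J])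
  have cyc: "fin_gen_monoid (generated_monoid (cycle_sums A J G))"
    by (rule fin_gen_cycle_sums[OF finite_A finite_G])
  have "fin_gen_monoid {x \<in> {x \<in> {x \<in> X. f x \<in> nonneg_vecs J}. g x \<in> nonneg_vecs J}.
      g x - f x \<in> generated_monoid (cycle_sums A J G)}"
    by (intro fin_gen_monoid_preimage f_add g_add nn cyc X) (simp add: f_add g_add)
  also have "{x \<in> {x \<in> {x \<in> X. f x \<in> nonneg_vecs J}. g x \<in> nonneg_vecs J}.
      g x - f x \<in> generated_monoid (cycle_sums A J G)} = W"
    unfolding W_def by blast
  finally show ?thesis .
qed

text \<open>Each vertex lies on a closed walk based at the projection of \<open>c\<close> and coming
  from \<open>Z\<close>. Concatenating finitely many of these corresponds to adding elements of
  \<open>Z\<close>.\<close>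

lemma total_tour:
  obtains z w where "z \<in> Z" "tour A J G (drop_on J c) w" "sum_list w = g z - f z"
proof -
  have "\<exists>z\<in>Z. \<exists>w. closed_walk A J G (drop_on J c) w \<and> (\<forall>p\<in>F. visits J (drop_on J c) w p) \<and>
      sum_list w = g z - f z" if "F \<subseteq> G" for F
    using finite_subset[OF that finite_G] that
  proof (induction F rule: finite_induct)
    case empty
    have "0 \<in> Z" "reach A (c + f 0) (c + g 0)"
      using additive_Z by (simp_all add: additive_monoid_def f_zero g_zero)
    from closed_walk_through[OF this(1) rtranclp.rtrancl_refl this(2)] show ?case
      using \<open>0 \<in> Z\<close> by (metis empty_iff)
  next
    case (insert p F)
    then obtain z w where z: "z \<in> Z" "closed_walk A J G (drop_on J c) w"
      "\<forall>p\<in>F. visits J (drop_on J c) w p" "sum_list w = g z - f z" by blast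
    obtain q where q: "q \<in> visited" "p = drop_on J q" using insert.prems by blast
    then obtain x where x: "x \<in> Z" "reach A (c + f x) q" "reach A q (c + g x)"
      unfolding visited_def by blast
    from closed_walk_through[OF this]
    obtain v where v: "closed_walk A J G (drop_on J c) v" "visits J (drop_on J c) v p"
      "sum_list v = g x - f x" unfolding q(2) by blast
    have "closed_walk A J G (drop_on J c) (v @ w)"
      using v(1) z(2) unfolding closed_walk_def by (simp add: walk_append drop_on_add)
    moreover have "\<forall>p\<in>insert p F. visits J (drop_on J c) (v @ w) p"
      using v(1,2) z(3) visits_prefix visits_suffix unfolding closed_walk_def by blast
    moreover have "sum_list (v @ w) = g (x + z) - f (x + z)"
      by (simp add: v(3) z(4) f_add g_add)
    moreover have "x + z \<in> Z" using x(1) z(1) additive_Z by (simp add: additive_monoid_def)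
    ultimately show ?case by blast
  qed
  from this[OF subset_refl] show thesis using that unfolding tour_def by blast
qed

text \<open>Intraproductions add up, so one for each of the finitely many counters in
  \<open>J\<close> can be combined.\<close>

lemma total_intra:
  obtains x h where "intra x h" "\<And>i. i \<in> J \<Longrightarrow> 0 < h i"
proof -
  have "\<exists>x h. intra x h \<and> (\<forall>i\<in>F. 0 < h i)" if "F \<subseteq> J" for F
    using finite_subset[OF that finite_J] that
  proof (induction F rule: finite_induct)
    case empty
    then show ?case using intra_zero by blast
  next
    case (insert i F)
    then obtain x h where x: "intra x h" "\<forall>i\<in>F. 0 < h i" by blast
    obtain y k where y: "intra y k" "0 < k i" using insert.prems unfolding J_def by blast
    have "0 \<le> h" "0 \<le> k" using x y by (auto simp: intra_def)
    then have "\<forall>j\<in>insert i F. 0 < (h + k) j"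
      using x(2) y(2) by (auto simp: le_fun_def vec_apply add_pos_nonneg add_nonneg_pos)
    then show ?case using intra_add[OF x(1) y(1)] by blast
  qed
  from this[OF subset_refl] show thesis using that by blast
qed

text \<open>A total intraproduction \<open>z\<^sub>1\<close> makes the counters in \<open>J\<close> large enough for executing, \<open>k\<close> times, a
  closed walk of displacement \<open>g (z\<^sub>2 + w) - f (z\<^sub>2 + w)\<close>; the tour \<open>z\<^sub>2\<close> serves to connect the cycles
  making up the displacement of \<open>w\<close>.\<close>

lemma pump:
  obtains z1 z2 where "z1 \<in> Z" "z2 \<in> Z"
    "\<And>w. w \<in> W \<Longrightarrow> \<exists>N\<ge>1. \<forall>k. of_nat N * z1 + of_nat k * (z2 + w) \<in> Z"
proof -
  obtain z1 h where h: "intra z1 h" "\<And>i. i \<in> J \<Longrightarrow> 0 < h i" using total_intra by blast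
  obtain z2 t where z2: "z2 \<in> Z" "tour A J G (drop_on J c) t" "sum_list t = g z2 - f z2"
    using total_tour by blast
  have "\<exists>N\<ge>1. \<forall>k. of_nat N * z1 + of_nat k * (z2 + w) \<in> Z" if "w \<in> W" for w
  proof -
    have w: "w \<in> X" "f w \<in> nonneg_vecs J" "g w \<in> nonneg_vecs J"
      "g w - f w \<in> generated_monoid (cycle_sums A J G)" using \<open>w \<in> W\<close> by (auto simp: W_def)
    obtain u where u: "tour A J G (drop_on J c) u" "sum_list u = sum_list t + (g w - f w)"
      using tour_insert[OF w(4) z2(2)] by blast
    define r s where "r = f (z2 + w)" and "s = g (z2 + w)"
    have "z2 \<in> W" using Z_subset_W z2(1) by blast
    then have rs: "r \<in> nonneg_vecs J" "s \<in> nonneg_vecs J"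
      using w by (auto simp: r_def s_def f_add g_add W_def nonneg_vecs_def vec_apply)
    have sum: "s - r = sum_list u" unfolding r_def s_def u(2) z2(3) f_add g_add by simp
    \<comment> \<open>\<open>B\<close> bounds what one execution of \<open>u\<close> can take from a
      counter in \<open>J\<close>. Since \<open>h\<close> is at least 1 there, \<open>N\<close>
      copies of \<open>h\<close> supply enough.\<close>
    define B where "B = (\<Sum>a\<leftarrow>u. \<Sum>j\<in>J. \<bar>a j\<bar>)"
    define N where "N = Suc (nat B)"
    let ?x = "c + of_nat N * h"
    have Nh: "intra (of_nat N * z1) (of_nat N * h)" using h(1) by (rule intra_scale)
    then have nn: "0 \<le> of_nat N * h" by (simp add: intra_def)
    have x: "0 \<le> ?x" using c_nonneg nn by simp
    have bound: "(\<Sum>a\<leftarrow>u. \<Sum>j\<in>J. \<bar>a j\<bar>) \<le> ?x i" if "i \<in> J" for i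
    proof -
      have "B \<le> int N * 1" by (simp add: N_def)
      also have "\<dots> \<le> int N * h i" using h(2)[OF that] by (intro mult_left_mono) auto
      also have "\<dots> \<le> ?x i" using c_nonneg by (simp add: le_fun_def vec_apply)
      finally show ?thesis by (simp add: B_def)
    qed
    have "of_nat N * z1 + of_nat k * (z2 + w) \<in> Z" for k
    proof -
      have "closed_walk A J G (drop_on J ?x) u"
        using u(1) drop_on_start[OF Nh] by (simp add: tour_def)
      then have mid: "reach A (?x + of_nat k * r) (?x + of_nat k * s)"
        using closed_walk_fire_iterate[where J = J and G = G and x = ?x and w = u]
          finite_J G_nonneg x bound rs sum by blast
      have r0: "0 \<le> of_nat k * r" "0 \<le> of_nat k * s"
        using rs by (auto simp: nonneg_vecs_def intro!: scale_nonneg)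
      \<comment> \<open>The two halves of the \<open>N\<close>-fold intraproduction, lifted by
        \<open>of_nat k * r\<close> and \<open>of_nat k * s\<close>, lead to and from the iterated
        tour.\<close>
      have "reach A (c + f (of_nat N * z1) + of_nat k * r) (?x + of_nat k * r)"
        "reach A (?x + of_nat k * s) (c + g (of_nat N * z1) + of_nat k * s)"
        using Nh r0 unfolding intra_def by (blast intro: reach_add)+
      with mid have "reach A (c + f (of_nat N * z1) + of_nat k * r) (c + g (of_nat N * z1) + of_nat k * s)"
        by (meson rtranclp_trans)
      moreover have "of_nat N * z1 + of_nat k * (z2 + w) \<in> X"
      proof -
        have "of_nat N * z1 \<in> X" using Nh Z_X by (auto simp: intra_def)
        moreover have "of_nat k * (z2 + w) \<in> X"
          using additive_X Z_X[OF z2(1)] w(1) by (intro additive_monoid_scale) (auto simp: additive_monoid_def)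
        ultimately show ?thesis using additive_X by (simp add: additive_monoid_def)
      qed
      ultimately show ?thesis
        unfolding Z_def r_def s_def
        by (simp only: mem_Collect_eq f_add[of "of_nat N * z1"] g_add[of "of_nat N * z1"]
            additive_scale[of f, OF f_add] additive_scale[of g, OF g_add] add.assoc simp_thms)
    qed
    moreover have "1 \<le> N" by (simp add: N_def)
    ultimately show ?thesis by blast
  qed
  moreover have "z1 \<in> Z" using h(1) by (simp add: intra_def)
  ultimately show thesis using that z2(1) by blast
qed

text \<open>Taking \<open>k = 1\<close> in \<open>pump\<close> exhibits \<open>w\<close> as a
  difference of elements of \<open>Z\<close>; taking \<open>k = N\<close> gives the multiple of
  \<open>z1 + z2 + w\<close>.\<close>

lemma dominated:
  obtains z where "z \<in> Z" "\<And>w. w \<in> W \<Longrightarrow> (\<exists>v\<in>Z. v + w \<in> Z) \<and> (\<exists>N\<ge>1. of_nat N * (z + w) \<in> Z)"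
proof -
  obtain z1 z2 where z: "z1 \<in> Z" "z2 \<in> Z"
    and pump: "\<And>w. w \<in> W \<Longrightarrow> \<exists>N\<ge>1. \<forall>k. of_nat N * z1 + of_nat k * (z2 + w) \<in> Z"
    using pump by blast
  have "z1 + z2 \<in> Z" using z additive_Z by (simp add: additive_monoid_def)
  moreover have "(\<exists>v\<in>Z. v + w \<in> Z) \<and> (\<exists>N\<ge>1. of_nat N * (z1 + z2 + w) \<in> Z)" if "w \<in> W" for w
  proof -
    from pump[OF that] obtain N
      where N: "N \<ge> 1" "\<And>k. of_nat N * z1 + of_nat k * (z2 + w) \<in> Z" by blast
    have "of_nat N * z1 + z2 \<in> Z"
      using additive_monoid_scale[OF additive_Z z(1)] z(2) additive_Z by (simp add: additive_monoid_def)
    moreover have "(of_nat N * z1 + z2) + w \<in> Z" using N(2)[of 1] by (simp add: add.assoc)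
    moreover have "of_nat N * (z1 + z2 + w) \<in> Z" using N(2)[of N] by (simp add: algebra_simps)
    ultimately show ?thesis using N(1) by blast
  qed
  ultimately show thesis by (rule that)
qed

end

subsection \<open>Pseudo-linear sets\<close>

text \<open>Division with remainder, \<open>k = d * q + s\<close>: the sum consists of
  \<open>q\<close> copies of \<open>of_nat d * r\<close>, \<open>s\<close> copies of
  \<open>v + r\<close> and \<open>d - s\<close> copies of \<open>v\<close>.\<close>

lemma shift_absorbs_multiples:
  fixes r :: "'i \<Rightarrow> int"
  assumes Y: "additive_monoid Y" and d: "d \<ge> 1" "of_nat d * r \<in> Y" and v: "v \<in> Y" "v + r \<in> Y"
  shows "of_nat d * v + of_nat k * r \<in> Y"
proof -
  let ?q = "k div d" and ?s = "k mod d"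
  have k: "k = d * ?q + ?s" and s: "?s \<le> d" using d(1) by (auto simp: less_imp_le)
  have "of_nat d * v + of_nat k * r
      = of_nat ?q * (of_nat d * r) + (of_nat ?s * (v + r) + of_nat (d - ?s) * v)"
    using s by (subst k) (simp only: of_nat_add of_nat_mult of_nat_diff algebra_simps)
  also have "\<dots> \<in> Y"
    using Y d(2) v by (simp add: additive_monoid_def[of Y] additive_monoid_scale[OF Y])
  finally show ?thesis .
qed

text \<open>The image of \<open>W\<close> serves as the monoid in the definition of
  pseudo-linearity. Each of its interior vectors is a difference of elements in the image of
  \<open>Z\<close> and has a positive multiple there, so one shift absorbs all its
  multiples.\<close>

lemma pseudo_linear_translate:
  fixes h :: "('e \<Rightarrow> int) \<Rightarrow> ivec"
  assumes b: "b \<in> int_vecs n" and h: "\<And>x y. h (x + y) = h x + h y"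
    and W: "fin_gen_monoid W" "h ` W \<subseteq> int_vecs n" and Z: "additive_monoid Z" "Z \<subseteq> W"
    and z: "z \<in> Z" "\<And>w. w \<in> W \<Longrightarrow> (\<exists>v\<in>Z. v + w \<in> Z) \<and> (\<exists>N\<ge>1. of_nat N * (z + w) \<in> Z)"
  shows "pseudo_linear_set n ((\<lambda>x. b + h x) ` Z)"
proof -
  let ?Y = "h ` Z" and ?M = "h ` W"
  have h0: "h 0 = 0" using h[of 0 0] by (metis add_cancel_right_right)
  have Y: "additive_monoid ?Y"
    using Z(1) h0 unfolding additive_monoid_def by (auto simp: h[symmetric] intro!: image_eqI[of 0 h 0])
  have single: "\<exists>x\<in>?Y. \<forall>k. x + of_nat k * r \<in> ?Y" if r: "interior_vec r ?M" for r
  proof -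
    obtain w0 where w0: "w0 \<in> W" "r = h w0" using r unfolding interior_vec_def by blast
    obtain v where v: "v \<in> Z" "v + w0 \<in> Z" using z(2)[OF w0(1)] by blast
    \<comment> \<open>Interiority is applied to \<open>h z\<close>: it makes \<open>N * r\<close>
      equal to \<open>h (z + w)\<close>, a further multiple of which lies in the image of
      \<open>Z\<close>. The factor \<open>d\<close> is the product of both.\<close>
    have "h z \<in> ?M" using z(1) Z(2) by blast
    then obtain N :: int where N: "N \<ge> 1" "(\<lambda>i. N * r i) \<in> (+) (h z) ` ?M"
      using r unfolding interior_vec_def by blast
    then obtain w where w: "w \<in> W" "(\<lambda>i. N * r i) = h z + h w" by blast
    obtain N' where N': "N' \<ge> 1" "of_nat N' * (z + w) \<in> Z" using z(2)[OF w(1)] by blast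
    define d where "d = N' * nat N"
    have "int d = int N' * N" using N(1) by (simp add: d_def)
    then have "of_nat d * r = of_nat N' * (\<lambda>i. N * r i)"
      by (intro ext) (simp only: vec_apply mult.assoc)
    also have "\<dots> = h (of_nat N' * (z + w))"
      unfolding w(2) h[symmetric] additive_scale[of h, OF h] ..
    finally have d: "of_nat d * r \<in> ?Y" using N'(2) by simp
    have "d \<ge> 1" using N N' by (simp add: d_def)
    moreover have "h v \<in> ?Y" "h v + r \<in> ?Y" using v by (auto simp: w0(2) h[symmetric])
    ultimately have "of_nat d * h v + of_nat k * r \<in> ?Y" for k
      using shift_absorbs_multiples[OF Y _ d] by blast
    moreover have "of_nat d * h v \<in> ?Y" using additive_monoid_scale[OF Y] v by blast
    ultimately show ?thesis by blast
  qed
  have many: "\<exists>x\<in>?Y. \<forall>y\<in>generated_monoid R. x + y \<in> ?Y"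
    if "finite R" "\<forall>r\<in>R. interior_vec r ?M" for R
    using that
  proof (induction R rule: finite_induct)
    case empty
    have "generated_monoid {} \<subseteq> {0 :: ivec}"
      by (rule generated_monoid_minimal) (auto simp: additive_monoid_def)
    then show ?case using Y by (intro bexI[of _ 0]) (auto simp: additive_monoid_def)
  next
    case (insert r R)
    then obtain x where x: "x \<in> ?Y" "\<forall>y\<in>generated_monoid R. x + y \<in> ?Y" by blast
    obtain x' where x': "x' \<in> ?Y" "\<forall>k. x' + of_nat k * r \<in> ?Y" using single insert.prems by blast
    \<comment> \<open>The shifts for \<open>R\<close> and for \<open>r\<close> are added; each
      absorbs its own part of \<open>y\<close>.\<close>
    have "(x + x') + y \<in> ?Y" if "y \<in> generated_monoid (insert r R)" for y
    proof -
      have "\<exists>k. \<exists>u\<in>generated_monoid R. y = of_nat k * r + u"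
        using that
      proof (induction rule: generated_monoid_induct)
        case (inc y)
        then show ?case
        proof
          assume "y = r"
          then show ?thesis using generated_monoid_zero by (intro exI[of _ 1] bexI[of _ 0]) simp_all
        next
          assume "y \<in> R"
          then show ?thesis using generated_monoid_inc by (intro exI[of _ 0] bexI[of _ y]) simp_all
        qed
      next
        case zero
        show ?case using generated_monoid_zero by (intro exI[of _ 0] bexI[of _ 0]) simp_all
      next
        case (add y y')
        then obtain k u k' u' where "u \<in> generated_monoid R" "y = of_nat k * r + u"
          "u' \<in> generated_monoid R" "y' = of_nat k' * r + u'" by blast
        then have "u + u' \<in> generated_monoid R" "y + y' = of_nat (k + k') * r + (u + u')"
          by (auto simp: generated_monoid_add algebra_simps)
        then show ?case by blast
      qed
      then obtain k u where u: "u \<in> generated_monoid R" "y = of_nat k * r + u" by blast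
      have "(x + x') + y = (x + u) + (x' + of_nat k * r)" unfolding u(2) by (simp add: algebra_simps)
      also have "\<dots> \<in> ?Y" using Y x(2) x'(2) u(1) unfolding additive_monoid_def by blast
      finally show ?thesis .
    qed
    moreover have "x + x' \<in> ?Y" using Y x(1) x'(1) unfolding additive_monoid_def by blast
    ultimately show ?case by blast
  qed
  have eq: "(\<lambda>x. b + h x) ` Z = (+) b ` ?Y" by (simp add: image_image)
  have "\<exists>x\<in>(+) b ` ?Y. (+) x ` generated_monoid R \<subseteq> (+) b ` ?Y"
    if R: "finite R" "\<forall>r\<in>R. interior_vec r ?M" for R
  proof -
    obtain x where x: "x \<in> ?Y" "\<forall>y\<in>generated_monoid R. x + y \<in> ?Y" using many[OF R] by blast
    then have "(+) (b + x) ` generated_monoid R \<subseteq> (+) b ` ?Y" by (auto simp: add.assoc)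
    with x(1) show ?thesis by blast
  qed
  moreover have "h x \<in> int_vecs n" if "x \<in> Z" for x
    using that W(2) Z(2) by blast
  then have "(+) b ` ?Y \<subseteq> int_vecs n"
    using b by (auto simp: int_vecs_def vec_apply)
  moreover have "fin_gen_monoid ?M" using fin_gen_monoid_image[of h, OF h W(1)] .
  ultimately show ?thesis
    unfolding pseudo_linear_set_def eq using b W(2) Z(2)
    by (intro conjI exI[of _ b] exI[of _ ?M]) auto
qed

subsection \<open>Runs\<close>

text \<open>The letters are transitions, given by source and target, so that Higman's order can
  compare the configurations along two runs.\<close>

fun run :: "('i \<Rightarrow> int) set \<Rightarrow> ('i \<Rightarrow> int) \<Rightarrow> (('i \<Rightarrow> int) \<times> ('i \<Rightarrow> int)) list \<Rightarrow> ('i \<Rightarrow> int) \<Rightarrow> bool" where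
  "run A x [] y \<longleftrightarrow> y = x \<and> 0 \<le> x"
| "run A x (l # w) y \<longleftrightarrow> fst l = x \<and> vstep A x (snd l) \<and> run A (snd l) w y"

lemma reach_run:
  assumes "reach A x y" "0 \<le> x"
  shows "\<exists>w. run A x w y"
  using assms
proof (induction rule: converse_rtranclp_induct)
  case base
  then show ?case by (intro exI[of _ "[]"]) simp
next
  case (step x x')
  then obtain w where "run A x' w y" by (auto simp: vstep_def)
  with step.hyps(1) show ?case by (intro exI[of _ "(x, x') # w"]) simp
qed

text \<open>Equal displacements make source and target of the larger transition exceed those of the
  smaller one by the same vector.\<close>

definition letter_le where
  "letter_le l l' \<longleftrightarrow> fst l \<le> fst l' \<and> snd l - fst l = snd l' - fst (l' :: ('i \<Rightarrow> int) \<times> ('i \<Rightarrow> int))"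

definition letters where
  "letters A I = {l. fst l \<in> nonneg_vecs I \<and> snd l - fst l \<in> A}"

lemma wqo_letter_le:
  assumes "finite A" "finite I"
  shows "wqo letter_le (letters A I)"
proof -
  have "wqo (\<lambda>l l'. fst l \<le> fst l') (letters A I)"
    by (rule wqo_inv_image[OF wqo_nonneg_vecs[OF assms(2)], where h = fst]) (auto simp: letters_def)
  moreover have "wqo (\<lambda>l l'. snd l - fst l = snd l' - fst l') (letters A I)"
    by (rule wqo_inv_image[OF wqo_finite_eq[OF assms(1)], where h = "\<lambda>l. snd l - fst l"])
      (auto simp: letters_def)
  ultimately have "wqo (\<lambda>l l'. fst l \<le> fst l' \<and> snd l - fst l = snd l' - fst l') (letters A I)"
    by (rule wqo_conj)
  then show ?thesis unfolding letter_le_def .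
qed

abbreviation configs where "configs x w \<equiv> x # map snd w"

lemma run_nonneg_vecs:
  assumes "run A x w y" "x \<in> nonneg_vecs I" "\<And>a i. a \<in> A \<Longrightarrow> i \<notin> I \<Longrightarrow> a i = 0"
  shows "set (configs x w) \<subseteq> nonneg_vecs I" "w \<in> lists (letters A I)"
proof -
  have "set (configs x w) \<subseteq> nonneg_vecs I \<and> w \<in> lists (letters A I)"
    using assms(1,2)
  proof (induction w arbitrary: x)
    case Nil
    then show ?case by simp
  next
    case (Cons l w)
    have l: "fst l = x" "vstep A x (snd l)" "run A (snd l) w y" using Cons.prems(1) by auto
    have "snd l i = 0" if "i \<notin> I" for i
    proof -
      have "(snd l - x) i = 0" using l(2) assms(3) that by (simp add: vstep_def)
      then show ?thesis using Cons.prems(2) that by (simp add: nonneg_vecs_def vec_apply)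
    qed
    then have "snd l \<in> nonneg_vecs I" using l(2) by (simp add: vstep_def nonneg_vecs_def)
    moreover have "l \<in> letters A I" using l(1,2) Cons.prems(2) by (simp add: letters_def vstep_def)
    ultimately show ?case using Cons.IH[OF l(3)] Cons.prems(2) by simp
  qed
  then show "set (configs x w) \<subseteq> nonneg_vecs I" "w \<in> lists (letters A I)" by auto
qed

section \<open>Chains of surpluses along a run\<close>

text \<open>\<open>u j\<close> is the surplus on entering configuration \<open>cs ! j\<close>, and
  \<open>u (Suc j)\<close> the surplus on leaving it, which the next step of the original run
  carries along unchanged.\<close>

definition chain where
  "chain A cs u \<longleftrightarrow> (\<forall>j\<le>length cs. 0 \<le> u j) \<and>
     (\<forall>j<length cs. reach A (cs ! j + u j) (cs ! j + u (Suc j)))"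

lemma chain_Cons:
  "chain A (c # cs) u \<longleftrightarrow> 0 \<le> u 0 \<and> reach A (c + u 0) (c + u (Suc 0)) \<and> chain A cs (u \<circ> Suc)"
proof
  assume u: "chain A (c # cs) u"
  show "0 \<le> u 0 \<and> reach A (c + u 0) (c + u (Suc 0)) \<and> chain A cs (u \<circ> Suc)"
    unfolding chain_def
  proof (intro conjI allI impI)
    show "0 \<le> u 0" "reach A (c + u 0) (c + u (Suc 0))" using u by (auto simp: chain_def)
    show "0 \<le> (u \<circ> Suc) j" if "j \<le> length cs" for j using u that by (simp add: chain_def)
    show "reach A (cs ! j + (u \<circ> Suc) j) (cs ! j + (u \<circ> Suc) (Suc j))" if "j < length cs" for j
      using u that unfolding chain_def by fastforce
  qed
next
  assume u: "0 \<le> u 0 \<and> reach A (c + u 0) (c + u (Suc 0)) \<and> chain A cs (u \<circ> Suc)"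
  show "chain A (c # cs) u"
    unfolding chain_def
  proof (intro conjI allI impI)
    show "0 \<le> u j" if "j \<le> length (c # cs)" for j
      using u that by (cases j) (auto simp: chain_def)
    show "reach A ((c # cs) ! j + u j) ((c # cs) ! j + u (Suc j))" if "j < length (c # cs)" for j
      using u that by (cases j) (auto simp: chain_def)
  qed
qed

lemma run_chain:
  assumes "run A x w y" "chain A (configs x w) u"
  shows "reach A (x + u 0) (y + u (Suc (length w)))"
  using assms
proof (induction w arbitrary: x u)
  case Nil
  then show ?case by (simp add: chain_def)
next
  case (Cons l w)
  have 1: "reach A (x + u 0) (x + u 1)" "chain A (configs (snd l) w) (u \<circ> Suc)"
    using Cons.prems(2) by (auto simp: chain_Cons)
  have "0 \<le> u 1" using Cons.prems(2) by (simp add: chain_def)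
  then have "reach A (x + u 1) (snd l + u 1)"
    using Cons.prems(1) by (intro reach_add) auto
  also have "reach A (snd l + u 1) (y + u (Suc (length (l # w))))"
    using Cons.IH[OF _ 1(2)] Cons.prems(1) by simp
  finally (rtranclp_trans) show ?case using 1(1) by (rule rtranclp_trans[rotated])
qed

text \<open>Matched transitions of \<open>w'\<close> repeat those of \<open>w\<close> with a
  surplus; the stretches between them are the links of the chain. The induction generalises over
  \<open>x0\<close>, where the current link begins, while \<open>x'\<close> is the point reached on
  \<open>w'\<close>.\<close>

lemma embedding_chain:
  assumes "list_emb letter_le w w'" "run A x w y" "run A x' w' y'"
    and "reach A x0 x'" "x \<le> x0" "y \<le> y'"
  shows "\<exists>u. chain A (configs x w) u \<and> u 0 = x0 - x \<and> u (Suc (length w)) = y' - y"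
  using assms
proof (induction arbitrary: x x' x0 rule: list_emb.induct)
  case (list_emb_Nil w')
  have "reach A x' y'"
    using list_emb_Nil(2) by (induction w' arbitrary: x') (auto intro: converse_rtranclp_into_rtranclp)
  then have "reach A x0 y'" using list_emb_Nil(3) by (meson rtranclp_trans)
  then have "chain A (configs x []) (\<lambda>j. if j = 0 then x0 - x else y' - y)"
    using list_emb_Nil by (auto simp: chain_def)
  then show ?case by (intro exI[of _ "\<lambda>j. if j = 0 then x0 - x else y' - y"]) auto
next
  case (list_emb_Cons w w' l')
  then have "reach A x0 (snd l')" "run A (snd l') w' y'" by auto
  then show ?case using list_emb_Cons by blast
next
  case (list_emb_Cons2 l l' w w')
  have l: "fst l = x" "vstep A x (snd l)" "run A (snd l) w y" using list_emb_Cons2.prems(1) by auto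
  have l': "fst l' = x'" "vstep A x' (snd l')" "run A (snd l') w' y'"
    using list_emb_Cons2.prems(2) by auto
  have le: "x \<le> x'" and eq: "snd l' - snd l = x' - x"
    using list_emb_Cons2.hyps(1) l(1) l'(1) by (auto simp: letter_le_def algebra_simps)
  have "snd l \<le> snd l'" using le eq by (metis diff_ge_0_iff_ge)
  then obtain u where u: "chain A (configs (snd l) w) u" "u 0 = snd l' - snd l"
    "u (Suc (length w)) = y' - y"
    using list_emb_Cons2.IH[OF l(3) l'(3) rtranclp.rtrancl_refl _ list_emb_Cons2.prems(5)] by blast
  let ?u = "case_nat (x0 - x) u"
  have "?u \<circ> Suc = u" by auto
  then have "chain A (configs x (l # w)) ?u"
    using u(1,2) list_emb_Cons2.prems(3,4) by (simp add: chain_Cons eq)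
  then show ?case using u(3) by (intro exI[of _ ?u]) auto
qed

subsection \<open>Copies of a vector addition system\<close>

definition at_copy :: "nat \<Rightarrow> ('i \<Rightarrow> int) \<Rightarrow> nat \<times> 'i \<Rightarrow> int" where
  "at_copy j a = (\<lambda>(j', i). if j' = j then a i else 0)"

definition slice :: "nat \<Rightarrow> (nat \<times> 'i \<Rightarrow> int) \<Rightarrow> 'i \<Rightarrow> int" where
  "slice j s = (\<lambda>i. s (j, i))"

text \<open>Counter \<open>(j, i)\<close> is counter \<open>i\<close> of copy \<open>j\<close>.
  There are \<open>k + 1\<close> copies, one for each configuration of a run of length
  \<open>k\<close>.\<close>

definition copies :: "nat \<Rightarrow> ('i \<Rightarrow> int) set \<Rightarrow> (nat \<times> 'i \<Rightarrow> int) set" where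
  "copies k A = (\<Union>j\<le>k. at_copy j ` A)"

lemma slice_add: "slice j (s + t) = slice j s + slice j t"
  by (auto simp: slice_def vec_apply)

lemma reach_slice:
  assumes "reach (copies k A) s t"
  shows "reach A (slice j s) (slice j t)"
  using assms
proof (induction rule: rtranclp_induct)
  case base
  then show ?case by simp
next
  case (step t t')
  then obtain j' a where a: "a \<in> A" "t' - t = at_copy j' a"
    by (auto simp: vstep_def copies_def)
  have t': "t' p = t p + at_copy j' a p" for p
    using fun_cong[OF a(2), of p] by (simp add: vec_apply)
  show ?case
  proof (cases "j = j'")
    case True
    then have "slice j t' - slice j t = a"
      using t' by (auto simp: slice_def at_copy_def vec_apply)
    then have "vstep A (slice j t) (slice j t')"
      using step.hyps(2) a(1) by (auto simp: vstep_def slice_def le_fun_def vec_apply)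
    then show ?thesis using step.IH by auto
  next
    case False
    then have "slice j t' = slice j t"
      using t' by (auto simp: slice_def at_copy_def)
    then show ?thesis using step.IH by simp
  qed
qed

text \<open>The copies act on disjoint counters, so they can be executed one after another.\<close>

lemma reach_copies:
  fixes s t :: "nat \<times> 'i \<Rightarrow> int"
  assumes nonneg: "0 \<le> s" and slices: "\<And>j. j \<le> k \<Longrightarrow> reach A (slice j s) (slice j t)"
    and off: "\<And>j i. k < j \<Longrightarrow> s (j, i) = t (j, i)"
  shows "reach (copies k A) s t"
proof -
  define upd where "upd j a s = (\<lambda>(j', i). if j' = j then a i else s (j', i))"
    for j and a :: "'i \<Rightarrow> int" and s :: "nat \<times> 'i \<Rightarrow> int"
  have upd: "reach (copies k A) (upd j a s) (upd j b s)"
    if "reach A a b" "0 \<le> s" "j \<le> k" for a b s j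
    using that(1)
  proof (induction rule: rtranclp_induct)
    case base
    then show ?case by simp
  next
    case (step b b')
    have "upd j b' s - upd j b s = at_copy j (b' - b)"
      by (auto simp: upd_def at_copy_def vec_apply)
    moreover have "0 \<le> upd j b s" "0 \<le> upd j b' s"
      using step.hyps(2) that(2) by (auto simp: upd_def vstep_def le_fun_def vec_apply)
    ultimately have "vstep (copies k A) (upd j b s) (upd j b' s)"
      using step.hyps(2) that(3) by (auto simp: vstep_def copies_def)
    then show ?case using step.IH by auto
  qed
  \<comment> \<open>In \<open>hyb m\<close> the first \<open>m\<close> copies have reached
    \<open>t\<close> and everything else is still as in \<open>s\<close>.\<close>
  define hyb where "hyb m = (\<lambda>(j, i). if j < m then t (j, i) else s (j, i))" for m
  have "reach (copies k A) s (hyb m)" if "m \<le> Suc k" for m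
    using that
  proof (induction m)
    case 0
    then show ?case by (simp add: hyb_def)
  next
    case (Suc m)
    then have IH: "reach (copies k A) s (hyb m)" by simp
    have "0 \<le> hyb m" using reach_nonneg[OF IH nonneg] .
    then have "reach (copies k A) (upd m (slice m s) (hyb m)) (upd m (slice m t) (hyb m))"
      using slices Suc.prems by (intro upd) auto
    moreover have "upd m (slice m s) (hyb m) = hyb m" "upd m (slice m t) (hyb m) = hyb (Suc m)"
      by (auto simp: upd_def hyb_def slice_def less_Suc_eq)
    ultimately show ?case using IH by (metis rtranclp_trans)
  qed
  moreover have "hyb (Suc k) = t" using off by (auto simp: hyb_def less_Suc_eq_le not_le)
  ultimately show ?thesis by (metis order_refl)
qed

subsection \<open>Reachability between linear sets\<close>

lemma nat_vecs_eq: "nat_vecs n = nonneg_vecs {..<n}"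
  by (auto simp: nat_vecs_def nonneg_vecs_def int_vecs_def le_fun_def zero_fun_apply not_less)
    (metis not_less order_refl)

text \<open>The conditions on \<open>P\<close> and \<open>Q\<close> keep the end points in the two
  linear sets; the componentwise order makes the first and the last surplus nonnegative.\<close>

definition run_le where
  "run_le P Q = (\<lambda>(x, w, y) (x', w', y').
     (x' - x \<in> P \<and> y' - y \<in> Q) \<and> (x \<le> x' \<and> y \<le> y') \<and> list_emb letter_le w w')"

text \<open>A chain along the run is encoded as one vector \<open>s\<close> whose slice
  \<open>j\<close> is the surplus \<open>u j\<close>. The chains ending in \<open>P\<close> and
  \<open>Q\<close> then form the monoid \<open>Z\<close> of a transformer, and \<open>Y\<close>
  collects the targets they lead to.\<close>

lemma pseudo_linear_above_run:
  fixes P Q :: "ivec set"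
  assumes A: "finite A" "A \<subseteq> int_vecs n"
    and P: "fin_gen_monoid P" "P \<subseteq> int_vecs n" and Q: "fin_gen_monoid Q" "Q \<subseteq> int_vecs n"
    and S: "(+) s0 ` P \<subseteq> nat_vecs n"
    and run: "run A x w y" "x \<in> (+) s0 ` P" "y \<in> (+) t0 ` Q"
  obtains Y where "pseudo_linear_set n Y"
    "Y \<subseteq> {y \<in> (+) t0 ` Q. \<exists>x\<in>(+) s0 ` P. reach A x y}"
    "\<And>x' w' y'. run A x' w' y' \<Longrightarrow> run_le P Q (x, w, y) (x', w', y') \<Longrightarrow> y' \<in> Y"
proof -
  define k where "k = length w"
  define I where "I = {..k} \<times> {..<n}"
  define I' where "I' = {..Suc k} \<times> {..<n}"
  define c :: "nat \<times> nat \<Rightarrow> int" where "c = (\<lambda>(j, i). if j \<le> k then (configs x w ! j) i else 0)"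
  \<comment> \<open>Copy \<open>j\<close> starts with surplus \<open>slice j s\<close> and ends with
    \<open>slice (Suc j) s\<close>. This shift of the index makes consecutive links fit
    together.\<close>
  define f :: "(nat \<times> nat \<Rightarrow> int) \<Rightarrow> nat \<times> nat \<Rightarrow> int"
    where "f = (\<lambda>s (j, i). if j \<le> k then s (j, i) else 0)"
  define g :: "(nat \<times> nat \<Rightarrow> int) \<Rightarrow> nat \<times> nat \<Rightarrow> int"
    where "g = (\<lambda>s (j, i). if j \<le> k then s (Suc j, i) else 0)"
  define X where "X = {s \<in> {s \<in> nonneg_vecs I'. slice 0 s \<in> P}. slice (Suc k) s \<in> Q}"
  have A_zero: "a i = 0" if "a \<in> A" "i \<notin> {..<n}" for a i
    using A(2) that by (auto simp: int_vecs_def)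
  have x: "x \<in> nonneg_vecs {..<n}" using run(2) S by (auto simp: nat_vecs_eq)
  have configs: "set (configs x w) \<subseteq> nonneg_vecs {..<n}"
    using run_nonneg_vecs(1)[OF run(1) x] A_zero by blast
  have config: "configs x w ! j \<in> nonneg_vecs {..<n}" if "j \<le> k" for j
    using configs nth_mem[of j "configs x w"] that by (auto simp: k_def)
  have "y \<in> set (configs x w)"
    using run(1) by (induction w arbitrary: x) auto
  then have y: "y \<in> int_vecs n"
    using configs by (auto simp: nonneg_vecs_def int_vecs_def not_less)
  have slice_f: "slice j (c + f s) = configs x w ! j + slice j s"
    and slice_g: "slice j (c + g s) = configs x w ! j + slice (Suc j) s" if "j \<le> k" for j s
    using that by (auto simp: slice_def c_def f_def g_def vec_apply)
  interpret transformer "copies k A" I c X f g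
  proof
    show "finite (copies k A)" using A(1) by (simp add: copies_def)
    show "finite I" by (simp add: I_def)
    show "a p = 0" if "a \<in> copies k A" "p \<notin> I" for a p
      using that A_zero by (cases p) (auto simp: copies_def at_copy_def I_def)
    show "c \<in> nonneg_vecs I"
      using config by (auto simp: nonneg_vecs_def c_def I_def le_fun_def vec_apply)
    show "f (s + t) = f s + f t" "g (s + t) = g s + g t" for s t
      by (auto simp: f_def g_def vec_apply)
    show "fin_gen_monoid X"
      unfolding X_def by (intro fin_gen_monoid_preimage slice_add P Q fin_gen_monoid_nonneg_vecs)
        (simp add: I'_def)
    show "f s \<in> nonneg_vecs I" if "s \<in> X" for s
      using that by (auto simp: X_def f_def nonneg_vecs_def I_def I'_def le_fun_def vec_apply)
    show "g s \<in> nonneg_vecs I" if "s \<in> X" for s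
      using that by (auto simp: X_def g_def nonneg_vecs_def I_def I'_def le_fun_def vec_apply)
  qed
  define Y where "Y = (\<lambda>s. y + slice (Suc k) s) ` Z"
  obtain z where "z \<in> Z" "\<And>s. s \<in> W \<Longrightarrow> (\<exists>v\<in>Z. v + s \<in> Z) \<and> (\<exists>N\<ge>1. of_nat N * (z + s) \<in> Z)"
    using dominated by blast
  moreover have "slice (Suc k) ` W \<subseteq> int_vecs n"
  proof -
    have "W \<subseteq> X" unfolding W_def by blast
    then show ?thesis using Q(2) unfolding X_def by blast
  qed
  ultimately have 1: "pseudo_linear_set n Y"
    unfolding Y_def using pseudo_linear_translate[where h = "slice (Suc k)",
        OF y slice_add fin_gen_W _ additive_Z Z_subset_W]
    by blast
  have 2: "Y \<subseteq> {y \<in> (+) t0 ` Q. \<exists>x\<in>(+) s0 ` P. reach A x y}"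
  proof
    fix y' assume "y' \<in> Y"
    then obtain s where s: "s \<in> Z" "y' = y + slice (Suc k) s" unfolding Y_def by blast
    then have sX: "s \<in> X" and "reach (copies k A) (c + f s) (c + g s)" by (auto simp: Z_def)
    then have "reach A (configs x w ! j + slice j s) (configs x w ! j + slice (Suc j) s)" if "j \<le> k" for j
      using reach_slice[of k A "c + f s" "c + g s" j] that by (simp add: slice_f slice_g)
    moreover have "0 \<le> slice j s" for j
      using sX by (auto simp: X_def nonneg_vecs_def slice_def le_fun_def vec_apply)
    ultimately have "chain A (configs x w) (\<lambda>j. slice j s)"
      by (simp add: chain_def k_def less_Suc_eq_le)
    from run_chain[OF run(1) this] have "reach A (x + slice 0 s) y'"
      unfolding s(2) k_def by simp
    moreover have "x + slice 0 s \<in> (+) s0 ` P"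
      using run(2) sX fin_gen_monoid_additive[OF P(1)] by (auto simp: X_def additive_monoid_def add.assoc)
    moreover have "y' \<in> (+) t0 ` Q"
      using run(3) sX fin_gen_monoid_additive[OF Q(1)] unfolding s(2)
      by (auto simp: X_def additive_monoid_def add.assoc)
    ultimately show "y' \<in> {y \<in> (+) t0 ` Q. \<exists>x\<in>(+) s0 ` P. reach A x y}" by blast
  qed
  have 3: "y' \<in> Y" if run': "run A x' w' y'" and le: "run_le P Q (x, w, y) (x', w', y')" for x' w' y'
  proof -
    have le: "x' - x \<in> P" "y' - y \<in> Q" "x \<le> x'" "y \<le> y'" "list_emb letter_le w w'"
      using le by (auto simp: run_le_def)
    obtain u where u: "chain A (configs x w) u" "u 0 = x' - x" "u (Suc k) = y' - y"
      using embedding_chain[OF le(5) run(1) run' rtranclp.rtrancl_refl le(3,4)] by (auto simp: k_def)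
    have u_reach: "reach A (configs x w ! j + u j) (configs x w ! j + u (Suc j))" if "j \<le> k" for j
      using u(1) that by (simp add: chain_def k_def)
    have u_nonneg: "0 \<le> u j" if "j \<le> Suc k" for j
      using u(1) that by (simp add: chain_def k_def)
    \<comment> \<open>The first surplus lies in \<open>P\<close> and so vanishes beyond dimension
      \<open>n\<close>; the links of the chain preserve this.\<close>
    have u_off: "u j i = 0" if "j \<le> Suc k" "\<not> i < n" for j i
      using that(1)
    proof (induction j)
      case 0
      then show ?case using le(1) P(2) that(2) by (auto simp: u(2) int_vecs_def)
    next
      case (Suc j)
      then show ?case
        using reach_zero_off[OF u_reach, of j i] A_zero that(2) by (simp add: vec_apply)
    qed
    define s :: "nat \<times> nat \<Rightarrow> int" where "s = (\<lambda>(j, i). if j \<le> Suc k then u j i else 0)"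
    have slice_s: "slice j s = u j" if "j \<le> Suc k" for j
      using that by (simp add: slice_def s_def)
    have "s \<in> nonneg_vecs I'"
      using u_nonneg u_off by (auto simp: nonneg_vecs_def s_def I'_def le_fun_def vec_apply)
    then have sX: "s \<in> X" using le(1,2) by (simp add: X_def slice_s u(2,3))
    have "reach (copies k A) (c + f s) (c + g s)"
    proof (rule reach_copies)
      show "0 \<le> c + f s" using c_nonneg f_nonneg[OF sX] by simp
      show "reach A (slice j (c + f s)) (slice j (c + g s))" if "j \<le> k" for j
        using u_reach[OF that] that by (simp add: slice_f slice_g slice_s)
      show "(c + f s) (j, i) = (c + g s) (j, i)" if "k < j" for j i
        using that by (simp add: c_def f_def g_def vec_apply)
    qed
    then have "s \<in> Z" using sX by (simp add: Z_def)
    moreover have "y' = y + slice (Suc k) s" by (simp add: slice_s u(3))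
    ultimately show ?thesis unfolding Y_def by blast
  qed
  show thesis using that[OF 1 2 3] .
qed

text \<open>Runs from \<open>S\<close> to \<open>T\<close> are well-quasi-ordered, so finitely many
  of them lie below all others, and each of these contributes one pseudo-linear set.\<close>

lemma semi_pseudo_linear_reach:
  assumes A: "finite A" "A \<subseteq> int_vecs n"
    and S: "linear_set n S" "S \<subseteq> nat_vecs n" and T: "linear_set n T"
  shows "semi_pseudo_linear_set n {y \<in> T. \<exists>x\<in>S. reach A x y}"
proof -
  obtain s0 P where P: "P \<subseteq> int_vecs n" "fin_gen_monoid P" "S = (+) s0 ` P"
    using S(1) unfolding linear_set_def by blast
  obtain t0 Q where Q: "Q \<subseteq> int_vecs n" "fin_gen_monoid Q" "T = (+) t0 ` Q"
    using T unfolding linear_set_def by blast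
  define \<Omega> where "\<Omega> = {(x, w, y). x \<in> S \<and> y \<in> T \<and> run A x w y}"
  have A_off: "a i = 0" if "a \<in> A" "i \<notin> {..<n}" for a i
    using A(2) that by (auto simp: int_vecs_def)
  have run_parts: "x \<in> nonneg_vecs {..<n} \<and> y \<in> nonneg_vecs {..<n} \<and> w \<in> lists (letters A {..<n})"
    if "(x, w, y) \<in> \<Omega>" for x w y
  proof -
    have x: "x \<in> nonneg_vecs {..<n}" and run: "run A x w y"
      using that S(2) by (auto simp: \<Omega>_def nat_vecs_eq)
    have "y \<in> set (configs x w)"
      using run by (induction w arbitrary: x) auto
    then show ?thesis using x run_nonneg_vecs[OF run x] A_off by blast
  qed
  have "wqo (run_le P Q) \<Omega>"
  proof -
    have words: "fst (snd r) \<in> lists (letters A {..<n})" if "r \<in> \<Omega>" for r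
      using run_parts[of "fst r" "fst (snd r)" "snd (snd r)"] that by simp
    have "wqo (\<lambda>r r'. fst r' - fst r \<in> P) \<Omega>"
      by (rule wqo_inv_image[OF wqo_fin_gen_monoid[OF P(2), of s0], where h = fst])
        (auto simp: \<Omega>_def P(3))
    moreover have "wqo (\<lambda>r r'. snd (snd r') - snd (snd r) \<in> Q) \<Omega>"
      by (rule wqo_inv_image[OF wqo_fin_gen_monoid[OF Q(2), of t0], where h = "\<lambda>r. snd (snd r)"])
        (auto simp: \<Omega>_def Q(3))
    moreover have "wqo (\<lambda>r r'. fst r \<le> fst r') \<Omega>"
      by (rule wqo_inv_image[OF wqo_nonneg_vecs[of "{..<n}"], where h = fst])
        (use run_parts in auto)
    moreover have "wqo (\<lambda>r r'. snd (snd r) \<le> snd (snd r')) \<Omega>"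
      by (rule wqo_inv_image[OF wqo_nonneg_vecs[of "{..<n}"], where h = "\<lambda>r. snd (snd r)"])
        (use run_parts in auto)
    moreover have "wqo (\<lambda>r r'. list_emb letter_le (fst (snd r)) (fst (snd r'))) \<Omega>"
      by (rule wqo_inv_image[OF higman[OF wqo_letter_le[OF A(1), of "{..<n}"]], where h = "\<lambda>r. fst (snd r)"])
        (use words in blast)+
    ultimately have "wqo (\<lambda>r r'. (fst r' - fst r \<in> P \<and> snd (snd r') - snd (snd r) \<in> Q) \<and>
        (fst r \<le> fst r' \<and> snd (snd r) \<le> snd (snd r')) \<and>
        list_emb letter_le (fst (snd r)) (fst (snd r'))) \<Omega>"
      by (intro wqo_conj)
    then show ?thesis
      by (rule wqo_inv_image[where h = id]) (auto simp: run_le_def)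
  qed
  then obtain B where B: "finite B" "B \<subseteq> \<Omega>" "\<And>r. r \<in> \<Omega> \<Longrightarrow> \<exists>b\<in>B. b = r \<or> run_le P Q b r"
    by (rule wqo_finite_basis) blast
  let ?D = "{y \<in> T. \<exists>x\<in>S. reach A x y}"
  have "\<exists>Y. pseudo_linear_set n Y \<and> Y \<subseteq> ?D \<and>
      (\<forall>x' w' y'. run A x' w' y' \<longrightarrow> run_le P Q b (x', w', y') \<longrightarrow> y' \<in> Y)" if "b \<in> B" for b
  proof -
    obtain x w y where b: "b = (x, w, y)" by (cases b)
    then have run: "run A x w y" "x \<in> (+) s0 ` P" "y \<in> (+) t0 ` Q"
      using B(2) that by (auto simp: \<Omega>_def P(3) Q(3))
    show ?thesis
    proof (rule pseudo_linear_above_run[OF A P(2,1) Q(2,1) S(2)[unfolded P(3)] run])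
      fix Y
      assume "pseudo_linear_set n Y" "Y \<subseteq> {y \<in> (+) t0 ` Q. \<exists>x\<in>(+) s0 ` P. reach A x y}"
        "\<And>x' w' y'. run A x' w' y' \<Longrightarrow> run_le P Q (x, w, y) (x', w', y') \<Longrightarrow> y' \<in> Y"
      then show ?thesis unfolding P(3) Q(3) b by blast
    qed
  qed
  then have "\<exists>Y. \<forall>b\<in>B. pseudo_linear_set n (Y b) \<and> Y b \<subseteq> ?D \<and>
      (\<forall>x' w' y'. run A x' w' y' \<longrightarrow> run_le P Q b (x', w', y') \<longrightarrow> y' \<in> Y b)"
    by (intro bchoice) blast
  then obtain Y where Y: "\<And>b. b \<in> B \<Longrightarrow> pseudo_linear_set n (Y b)" "\<And>b. b \<in> B \<Longrightarrow> Y b \<subseteq> ?D"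
    "\<And>b x' w' y'. b \<in> B \<Longrightarrow> run A x' w' y' \<Longrightarrow> run_le P Q b (x', w', y') \<Longrightarrow> y' \<in> Y b"
    by blast
  have "?D \<subseteq> \<Union> (Y ` B)"
  proof
    fix y assume "y \<in> ?D"
    then obtain x where x: "y \<in> T" "x \<in> S" "reach A x y" by blast
    then have "0 \<le> x" using S(2) by (auto simp: nat_vecs_eq nonneg_vecs_def)
    then obtain w where w: "run A x w y" using reach_run[OF x(3)] by blast
    then have "(x, w, y) \<in> \<Omega>" using x by (simp add: \<Omega>_def)
    then obtain b where b: "b \<in> B" "b = (x, w, y) \<or> run_le P Q b (x, w, y)" using B(3) by blast
    \<comment> \<open>Reflexivity covers the case that the run itself is the basis element.\<close>
    moreover have "run_le P Q (x, w, y) (x, w, y)"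
      using fin_gen_monoid_additive[OF P(2)] fin_gen_monoid_additive[OF Q(2)]
      by (auto simp: run_le_def additive_monoid_def letter_le_def intro!: list_emb_refl)
    ultimately have "run_le P Q b (x, w, y)" by blast
    then show "y \<in> \<Union> (Y ` B)" using Y(3)[OF b(1) w] b(1) by blast
  qed
  then have "?D = \<Union> (Y ` B)" using Y(2) by blast
  then show ?thesis
    unfolding semi_pseudo_linear_set_def using B(1) Y(1) by (intro exI[of _ "Y ` B"]) auto
qed

lemma semi_pseudo_linear_UN:
  assumes "finite F" "\<And>i. i \<in> F \<Longrightarrow> semi_pseudo_linear_set n (D i)"
  shows "semi_pseudo_linear_set n (\<Union>i\<in>F. D i)"
proof -
  have "\<forall>i\<in>F. \<exists>E. finite E \<and> (\<forall>Y\<in>E. pseudo_linear_set n Y) \<and> D i = \<Union>E"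
    using assms(2) unfolding semi_pseudo_linear_set_def by blast
  from bchoice[OF this] obtain E
    where E: "\<forall>i\<in>F. finite (E i) \<and> (\<forall>Y\<in>E i. pseudo_linear_set n Y) \<and> D i = \<Union>(E i)" by blast
  have "(\<Union>i\<in>F. D i) = \<Union>(\<Union>(E ` F))" using E by auto
  moreover have "finite (\<Union>(E ` F))" using assms(1) E by blast
  moreover have "\<forall>Y\<in>\<Union>(E ` F). pseudo_linear_set n Y" using E by blast
  ultimately show ?thesis unfolding semi_pseudo_linear_set_def by blast
qed

text \<open>Reachability is distributed over the linear components of \<open>S\<close> and of the
  intersecting set, which leaves finitely many pairs of linear sets.\<close>

lemma Petri_set_reach:
  assumes A: "finite A" "A \<subseteq> int_vecs n" and S: "semilinear_set n S" "S \<subseteq> nat_vecs n"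
  shows "Petri_set n {y \<in> nat_vecs n. \<exists>x\<in>S. reach A x y}" (is "Petri_set n ?R")
  unfolding Petri_set_def
proof (intro conjI allI impI)
  show "?R \<subseteq> int_vecs n" by (auto simp: nat_vecs_def)
  fix T assume "semilinear_set n T"
  then obtain E where E: "finite E" "\<forall>L\<in>E. linear_set n L" "T = \<Union>E"
    unfolding semilinear_set_def by blast
  obtain F where F: "finite F" "\<forall>L\<in>F. linear_set n L" "S = \<Union>F"
    using S(1) unfolding semilinear_set_def by blast
  have "y \<in> nat_vecs n" if "x \<in> S" "reach A x y" for x y
  proof -
    have x: "x \<in> nonneg_vecs {..<n}" using that(1) S(2) by (auto simp: nat_vecs_eq)
    then have "0 \<le> y" using reach_nonneg[OF that(2)] by (simp add: nonneg_vecs_def)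
    moreover have "y i = 0" if "i \<notin> {..<n}" for i
    proof -
      have off: "a i = 0" if "a \<in> A" for a
        using subsetD[OF A(2) that] \<open>i \<notin> {..<n}\<close> by (simp add: int_vecs_def)
      have "y i = x i" using \<open>reach A x y\<close> off by (rule reach_zero_off)
      then show ?thesis using x that by (simp add: nonneg_vecs_def)
    qed
    ultimately show ?thesis by (simp add: nat_vecs_eq nonneg_vecs_def)
  qed
  then have "?R \<inter> T = (\<Union>(L, L')\<in>F \<times> E. {y \<in> L'. \<exists>x\<in>L. reach A x y})"
    unfolding E(3) F(3) by blast
  also have "semi_pseudo_linear_set n \<dots>"
  proof (rule semi_pseudo_linear_UN)
    show "finite (F \<times> E)" using E(1) F(1) by simp
    fix p assume "p \<in> F \<times> E"
    then show "semi_pseudo_linear_set n (case p of (L, L') \<Rightarrow> {y \<in> L'. \<exists>x\<in>L. reach A x y})"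
      using semi_pseudo_linear_reach[OF A] E(2) F(2,3) S(2) by (auto simp: Sup_le_iff)
  qed
  finally show "semi_pseudo_linear_set n (?R \<inter> T)" .
qed

subsection \<open>Forward and backward reachability sets\<close>

lemma vas_reach_iff:
  assumes "is_vas V"
  shows "vas_reach V x y \<longleftrightarrow> x \<in> nat_vecs (dimension V) \<and> reach (displacement V ` alphabet V) x y"
    (is "_ \<longleftrightarrow> _ \<in> ?N \<and> reach ?A _ _")
proof
  assume "vas_reach V x y"
  then obtain w where "vas_run V w x y" unfolding vas_reach_def by blast
  then show "x \<in> ?N \<and> reach ?A x y"
  proof (induction w arbitrary: x)
    case Nil
    then show ?case by simp
  next
    case (Cons a w)
    then obtain z where z: "vas_step V a x z" "reach ?A z y" by auto
    then have "vstep ?A x z" "x \<in> ?N"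
      by (auto simp: vas_step_def vstep_def nat_vecs_eq nonneg_vecs_def)
    with z(2) show ?case by (auto intro: converse_rtranclp_into_rtranclp)
  qed
next
  assume "x \<in> ?N \<and> reach ?A x y"
  then have "reach ?A x y" "x \<in> ?N" by auto
  then show "vas_reach V x y"
  proof (induction rule: converse_rtranclp_induct)
    case base
    then show ?case unfolding vas_reach_def by (intro bexI[of _ "[]"]) auto
  next
    case (step x z)
    then obtain a where a: "a \<in> alphabet V" "z - x = displacement V a"
      by (auto simp: vstep_def)
    then have z: "z = x + displacement V a" by (metis add.commute diff_add_cancel)
    have "displacement V a \<in> int_vecs (dimension V)" using assms a(1) by (simp add: is_vas_def)
    then have zN: "z \<in> ?N"
      using step.hyps(1) step.prems unfolding z vstep_def nat_vecs_eq
      by (auto simp: nonneg_vecs_def int_vecs_def vec_apply)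
    then obtain w where "w \<in> lists (alphabet V)" "vas_run V w z y"
      using step.IH unfolding vas_reach_def by blast
    moreover have "vas_step V a x z" using a(1) z zN step.prems by (simp add: vas_step_def)
    ultimately show ?case using a(1) unfolding vas_reach_def by (intro bexI[of _ "a # w"]) auto
  qed
qed

text \<open>Negating all displacements reverses every step, so backward reachability becomes forward
  reachability in another vector addition system.\<close>

lemma reach_uminus: "reach (uminus ` A) x y \<longleftrightarrow> reach A y x"
proof -
  have "y - x \<in> uminus ` A \<longleftrightarrow> x - y \<in> A" for x y :: "'a \<Rightarrow> int"
    using inj_image_mem_iff[of uminus "x - y" A] by (simp add: inj_def)
  then have "vstep (uminus ` A) = (vstep A)\<inverse>\<inverse>"
    by (auto simp: vstep_def fun_eq_iff)
  then show ?thesis by (simp add: rtranclp_conversep)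
qed

theorem theorem6p4:
  fixes V :: "'a vas" and S S' :: "ivec set"
  assumes "is_vas V"
    and "S \<subseteq> nat_vecs (dimension V)" and "semilinear_set (dimension V) S"
    and "S' \<subseteq> nat_vecs (dimension V)" and "semilinear_set (dimension V) S'"
  shows "Petri_set (dimension V) (post_star V S) \<and> Petri_set (dimension V) (pre_star V S')"
proof
  let ?n = "dimension V" and ?A = "displacement V ` alphabet V"
  have A: "finite ?A" "?A \<subseteq> int_vecs ?n" using assms(1) by (auto simp: is_vas_def)
  have A': "finite (uminus ` ?A)" "uminus ` ?A \<subseteq> int_vecs ?n"
    using A by (auto simp: int_vecs_def)
  have "post_star V S = {y \<in> nat_vecs ?n. \<exists>x\<in>S. reach ?A x y}"
    using assms(2) unfolding post_star_def vas_reach_iff[OF assms(1)] by blast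
  then show "Petri_set ?n (post_star V S)" using Petri_set_reach[OF A assms(3,2)] by simp
  have "pre_star V S' = {y \<in> nat_vecs ?n. \<exists>x\<in>S'. reach (uminus ` ?A) x y}"
    unfolding pre_star_def vas_reach_iff[OF assms(1)] reach_uminus by blast
  then show "Petri_set ?n (pre_star V S')" using Petri_set_reach[OF A' assms(5,4)] by simp
qed

end
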